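(* Let $\mathbf{W}=\{W^n:\mathcal X^n\to\mathcal Y^n\times\mathcal Z^n\}_{n\in\mathbb N}$ be any general wiretap channel and let $i\in\{2,3,4,5,6\}$. Then the $(\varepsilon,i)$-secrecy capacity and the $(\varepsilon,i)$-optimistic secrecy capacity of $\mathbf W$ are $$C_\varepsilon^{(i)}(\mathbf W)=\sup_{\mathbf V-\mathbf X-(\mathbf Y,\mathbf Z)}\Big(\underline I_\varepsilon(\mathbf V;\mathbf Y)-\overline I(\mathbf V;\mathbf Z)\Big)\qquad\text{for all }\varepsilon\in[0,1),$$ $$\overline C_\varepsilon^{(i)}(\mathbf W)=\sup_{\mathbf V-\mathbf X-(\mathbf Y,\mathbf Z)}\Big(\overline I_\varepsilon(\mathbf V;\mathbf Y)-\overline I(\mathbf V;\mathbf Z)\Big)\qquad\text{for all }\varepsilon\in(0,1].$$ The suprema are over all sequences of distributions $P_{\mathbf V\mathbf X}=\{P_{V^nX^n}\}_{n\in\mathbb N}$, equivalently over all Markov chains $\mathbf V-\mathbf X-(\mathbf Y,\mathbf Z)$ (meaning that $V^n-X^n-(Y^n,Z^n)$ is a Markov chain for every $n$) in which the conditional distribution of $(Y^n,Z^n)$ given $X^n$ is $W^n$ for every $n$.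
   Context: A general wiretap channel is a sequence $\mathbf W=\{W^n\}_{n\in\mathbb N}$ of stochastic mappings $W^n:\mathcal X^n\to\mathcal Y^n\times\mathcal Z^n$ (no consistency, memorylessness or stationarity is assumed). Its marginal to the legitimate receiver is $W^n_{\mathcal Y}(\mathbf y|\mathbf x)=\sum_{\mathbf z}W^n(\mathbf y,\mathbf z|\mathbf x)$. Logarithms are to an arbitrary fixed base. Secrecy metrics. Let $\eta>0$ be an arbitrary constant, let $(M,Z^n)\sim P:=P_{MZ^n}$ and $Q:=P_M\times P_{Z^n}$. With $\mathbb V(P,Q)=\sup_{\mathcal A}|P(\mathcal A)-Q(\mathcal A)|$ the variational distance and $D$ the relative entropy: $\mathbb S_1=D(P\|Q)$; $\mathbb S_2=\mathbb V(P,Q)$; $\mathbb S_3^\eta=\Pr\big(\log\frac{P(M,Z^n)}{Q(M,Z^n)}>\eta\big)$; $\mathbb S_4=\frac1nD(P\|Q)$; $\mathbb S_5=\frac1n\mathbb V(P,Q)$; $\mathbb S_6^\eta=\Pr\big(\frac1n\log\frac{P(M,Z^n)}{Q(M,Z^n)}>\eta\big)$. Metrics 3 and 6 depend on the additional parameter $\eta>0$; the dependence of the codes on $\eta$ is suppressed in the notation, and $\mathbb S_i$ below means $\mathbb S_i^\eta$ when $i=3,6$. Codes. An $(n,M_n,\varepsilon_n,\delta_n)$-wiretap code for secrecy metric $i\in\{1,\dots,6\}$ consists of a message set $\mathcal M_n=\{1,\dots,M_n\}$, a stochastic encoder $Q_{X^n|M}:\mathcal M_n\to\mathcal X^n$ and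 a decoder $\varphi_n:\mathcal Y^n\to\mathcal M_n$ such that, with the message $M$ uniform on $\mathcal M_n$, the average error probability satisfies $\frac1{M_n}\sum_{m}\sum_{\mathbf x}Q_{X^n|M}(\mathbf x|m)W^n_{\mathcal Y}(\mathcal Y^n\setminus\varphi_n^{-1}(m)|\mathbf x)\le\varepsilon_n$, and the leakage satisfies $\mathbb S_i(P_{MZ^n},P_M\times P_{Z^n})\le\delta_n$. Capacities. For $\varepsilon\in[0,1)$, $R\in\mathbb R$ is $(\varepsilon,i)$-achievable if there is a sequence of $(n,M_n,\varepsilon_n,\delta_n)$-wiretap codes for secrecy metric $i$ with $\limsup_n\varepsilon_n\le\varepsilon$, $\lim_n\delta_n=0$ and $\liminf_n\frac1n\log M_n\ge R$; $C^{(i)}_\varepsilon(\mathbf W)$ is the supremum of all $(\varepsilon,i)$-achievable $R$. For $\varepsilon\in(0,1]$, $R\in\mathbb R$ is $(\varepsilon,i)$-optimistically achievable if every sequence of $(n,M_n,\varepsilon_n,\delta_n)$-wiretap codes for secrecy metric $i$ with $\liminf_n\frac1n\log M_n\ge R$ and $\lim_n\delta_n=0$ satisfies $\liminf_n\varepsilon_n\ge\varepsilon$; $\overline C^{(i)}_\varepsilon(\mathbf W)$ is the infimum of all $(\varepsilon,i)$-optimistically achievable $R$. Information spectrum quantities. For real random variables $\{B_n\}$, $\varepsilon\text{-p-}\liminf_n B_n:=\sup\{r:\limsup_n\Pr(B_n\le r)\le\varepsilon\}$ for $\varepsilon\in[0,1)$, and $\varepsilon\text{-p-}\limsup_n B_n:=\sup\{r:\liminf_n\Pr(B_n\le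 r)<\varepsilon\}$ for $\varepsilon\in(0,1]$. For $(\mathbf V,\mathbf Y)=\{(V^n,Y^n)\}_n$ let $\imath_n(V^n;Y^n)=\frac1n\log\frac{P_{Y^n|V^n}(Y^n|V^n)}{P_{Y^n}(Y^n)}$, $\underline I_\varepsilon(\mathbf V;\mathbf Y)=\varepsilon\text{-p-}\liminf_n\imath_n(V^n;Y^n)$, $\overline I_\varepsilon(\mathbf V;\mathbf Y)=\varepsilon\text{-p-}\limsup_n\imath_n(V^n;Y^n)$, and $\overline I:=\overline I_1$ (and likewise with $\mathbf Z$ in place of $\mathbf Y$).
   Formalization: Case i=5 is omitted (S_5≤1/n always vanishes, so the claim fails for the noiseless channel Y=Z=X), for i=6 the formulas are proved for the infimum over η>0 of the capacities (at fixed η they fail for the same channel), and processes with second term +∞ are left out of the suprema. *)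

theory Defs
  imports "HOL-Probability.Probability"
begin

text \<open>
  The alphabets are the types \<open>'x\<close>, \<open>'y\<close>, \<open>'z\<close>, of any cardinality, and a word of length \<open>n\<close>
  is a list. Distributions are discrete. Block lengths are the \<open>n \<ge> 1\<close>; whatever a sequence
  does at index 0 is ignored.
\<close>

definition wiretap_channel :: "(nat \<Rightarrow> 'x list \<Rightarrow> ('y list \<times> 'z list) pmf) \<Rightarrow> bool" where
  "wiretap_channel W \<longleftrightarrow>
     (\<forall>n\<ge>1. \<forall>x. length x = n \<longrightarrow> (\<forall>(y, z)\<in>set_pmf (W n x). length y = n \<and> length z = n))"


subsection \<open>Secrecy metrics\<close>

definition variational_distance :: "'a pmf \<Rightarrow> 'a pmf \<Rightarrow> real" where
  "variational_distance P Q = (SUP A. \<bar>measure_pmf.prob P A - measure_pmf.prob Q A\<bar>)"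

text \<open>\<^const>\<open>KL_divergence\<close> takes the reference measure first: \<open>D(P \<parallel> Q)\<close> is \<open>KL_divergence b Q P\<close>.\<close>

definition relative_entropy :: "real \<Rightarrow> 'a pmf \<Rightarrow> 'a pmf \<Rightarrow> real" where
  "relative_entropy b P Q = KL_divergence b (measure_pmf Q) (measure_pmf P)"

text \<open>
  Two pitfalls when these metrics are required to vanish. \<open>S5\<close> is at most \<open>1/n\<close> whatever \<open>P\<close>
  and \<open>Q\<close> are, hence always vanishes. \<open>S6\<close> at one fixed \<open>\<eta>\<close> tolerates a leakage rate of \<open>\<eta>\<close>;
  it expresses a vanishing leakage rate only when \<open>\<eta>\<close> is taken arbitrarily small.
\<close>

datatype leakage_metric = S1 | S2 | S3 | S4 | S5 | S6

fun secrecy_metric :: "real \<Rightarrow> leakage_metric \<Rightarrow> real \<Rightarrow> nat \<Rightarrow> 'a pmf \<Rightarrow> 'a pmf \<Rightarrow> real" where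
  "secrecy_metric b S1 \<eta> n P Q = relative_entropy b P Q"
| "secrecy_metric b S2 \<eta> n P Q = variational_distance P Q"
| "secrecy_metric b S3 \<eta> n P Q =
     measure_pmf.prob P {w. log b (pmf P w / pmf Q w) > \<eta>}"
| "secrecy_metric b S4 \<eta> n P Q = 1 / real n * relative_entropy b P Q"
| "secrecy_metric b S5 \<eta> n P Q = 1 / real n * variational_distance P Q"
| "secrecy_metric b S6 \<eta> n P Q =
     measure_pmf.prob P {w. 1 / real n * log b (pmf P w / pmf Q w) > \<eta>}"


subsection \<open>Codes\<close>

text \<open>
  A code for block length \<open>n\<close> is given by the number \<open>M\<close> of messages, the stochastic encoder
  \<open>enc\<close> and the decoder \<open>dec\<close>.
\<close>

definition message_output ::
  "(nat \<Rightarrow> 'x list \<Rightarrow> ('y list \<times> 'z list) pmf) \<Rightarrow> nat \<Rightarrow> nat \<Rightarrow> (nat \<Rightarrow> 'x list pmf)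
    \<Rightarrow> (nat \<times> 'z list) pmf" where
  "message_output W n M enc =
     do { m \<leftarrow> pmf_of_set {1..M}; x \<leftarrow> enc m; (y, z) \<leftarrow> W n x; return_pmf (m, z) }"

definition error_probability ::
  "(nat \<Rightarrow> 'x list \<Rightarrow> ('y list \<times> 'z list) pmf) \<Rightarrow> nat \<Rightarrow> nat \<Rightarrow> (nat \<Rightarrow> 'x list pmf)
    \<Rightarrow> ('y list \<Rightarrow> nat) \<Rightarrow> real" where
  "error_probability W n M enc dec =
     1 / real M * (\<Sum>m=1..M. measure_pmf.expectation (enc m)
        (\<lambda>x. measure_pmf.prob (map_pmf fst (W n x)) {y. dec y \<noteq> m}))"

definition leakage ::
  "real \<Rightarrow> (nat \<Rightarrow> 'x list \<Rightarrow> ('y list \<times> 'z list) pmf) \<Rightarrow> leakage_metric \<Rightarrow> real \<Rightarrow> nat \<Rightarrow> nat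
    \<Rightarrow> (nat \<Rightarrow> 'x list pmf) \<Rightarrow> real" where
  "leakage b W i \<eta> n M enc =
     (let P = message_output W n M enc
      in secrecy_metric b i \<eta> n P (pair_pmf (map_pmf fst P) (map_pmf snd P)))"

definition wiretap_code ::
  "real \<Rightarrow> (nat \<Rightarrow> 'x list \<Rightarrow> ('y list \<times> 'z list) pmf) \<Rightarrow> leakage_metric \<Rightarrow> real \<Rightarrow> nat \<Rightarrow> nat
    \<Rightarrow> real \<Rightarrow> real \<Rightarrow> (nat \<Rightarrow> 'x list pmf) \<Rightarrow> ('y list \<Rightarrow> nat) \<Rightarrow> bool" where
  "wiretap_code b W i \<eta> n M e d enc dec \<longleftrightarrow>
     M \<ge> 1 \<and>
     (\<forall>m\<in>{1..M}. \<forall>x\<in>set_pmf (enc m). length x = n) \<and>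
     (\<forall>y. length y = n \<longrightarrow> dec y \<in> {1..M}) \<and>
     error_probability W n M enc dec \<le> e \<and>
     leakage b W i \<eta> n M enc \<le> d"


subsection \<open>Capacities\<close>

definition achievable ::
  "real \<Rightarrow> (nat \<Rightarrow> 'x list \<Rightarrow> ('y list \<times> 'z list) pmf) \<Rightarrow> leakage_metric \<Rightarrow> real \<Rightarrow> real \<Rightarrow> real \<Rightarrow> bool"
where
  "achievable b W i \<eta> \<epsilon> R \<longleftrightarrow>
     (\<exists>M e d enc dec.
        (\<forall>n\<ge>1. wiretap_code b W i \<eta> n (M n) (e n) (d n) (enc n) (dec n)) \<and>
        limsup (\<lambda>n. ereal (e n)) \<le> ereal \<epsilon> \<and>
        d \<longlonglongrightarrow> 0 \<and>
        liminf (\<lambda>n. ereal (1 / real n * log b (real (M n)))) \<ge> ereal R)"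

definition secrecy_capacity ::
  "real \<Rightarrow> (nat \<Rightarrow> 'x list \<Rightarrow> ('y list \<times> 'z list) pmf) \<Rightarrow> leakage_metric \<Rightarrow> real \<Rightarrow> real \<Rightarrow> ereal" where
  "secrecy_capacity b W i \<eta> \<epsilon> = Sup (ereal ` {R. achievable b W i \<eta> \<epsilon> R})"

definition optimistically_achievable ::
  "real \<Rightarrow> (nat \<Rightarrow> 'x list \<Rightarrow> ('y list \<times> 'z list) pmf) \<Rightarrow> leakage_metric \<Rightarrow> real \<Rightarrow> real \<Rightarrow> real \<Rightarrow> bool"
where
  "optimistically_achievable b W i \<eta> \<epsilon> R \<longleftrightarrow>
     (\<forall>M e d enc dec.
        (\<forall>n\<ge>1. wiretap_code b W i \<eta> n (M n) (e n) (d n) (enc n) (dec n)) \<longrightarrow>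
        liminf (\<lambda>n. ereal (1 / real n * log b (real (M n)))) \<ge> ereal R \<longrightarrow>
        d \<longlonglongrightarrow> 0 \<longrightarrow>
        liminf (\<lambda>n. ereal (e n)) \<ge> ereal \<epsilon>)"

definition optimistic_secrecy_capacity ::
  "real \<Rightarrow> (nat \<Rightarrow> 'x list \<Rightarrow> ('y list \<times> 'z list) pmf) \<Rightarrow> leakage_metric \<Rightarrow> real \<Rightarrow> real \<Rightarrow> ereal" where
  "optimistic_secrecy_capacity b W i \<eta> \<epsilon> =
     Inf (ereal ` {R. optimistically_achievable b W i \<eta> \<epsilon> R})"


subsection \<open>Information spectrum quantities\<close>

text \<open>A sequence of real random variables enters only through the laws \<open>B n\<close> of its members.\<close>

definition eps_p_liminf :: "real \<Rightarrow> (nat \<Rightarrow> real pmf) \<Rightarrow> ereal" where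
  "eps_p_liminf \<epsilon> B =
     Sup (ereal ` {r. limsup (\<lambda>n. ereal (measure_pmf.prob (B n) {..r})) \<le> ereal \<epsilon>})"

definition eps_p_limsup :: "real \<Rightarrow> (nat \<Rightarrow> real pmf) \<Rightarrow> ereal" where
  "eps_p_limsup \<epsilon> B =
     Sup (ereal ` {r. liminf (\<lambda>n. ereal (measure_pmf.prob (B n) {..r})) < ereal \<epsilon>})"

text \<open>The law of \<open>1/n log (P(Y|V) / P(Y))\<close> for a pair \<open>(V, Y)\<close> with joint distribution \<open>J\<close>.\<close>

definition info_density_law :: "real \<Rightarrow> nat \<Rightarrow> ('v \<times> 'u) pmf \<Rightarrow> real pmf" where
  "info_density_law b n J =
     map_pmf (\<lambda>(v, y). 1 / real n *
       log b ((pmf J (v, y) / pmf (map_pmf fst J) v) / pmf (map_pmf snd J) y)) J"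

definition info_lower :: "real \<Rightarrow> real \<Rightarrow> (nat \<Rightarrow> ('v \<times> 'u) pmf) \<Rightarrow> ereal" where
  "info_lower b \<epsilon> J = eps_p_liminf \<epsilon> (\<lambda>n. info_density_law b n (J n))"

definition info_upper :: "real \<Rightarrow> real \<Rightarrow> (nat \<Rightarrow> ('v \<times> 'u) pmf) \<Rightarrow> ereal" where
  "info_upper b \<epsilon> J = eps_p_limsup \<epsilon> (\<lambda>n. info_density_law b n (J n))"

text \<open>
  The distributions of \<open>(V\<^sup>n, X\<^sup>n)\<close>. A discrete \<open>V\<^sup>n\<close> takes at most countably many values, and
  none of the quantities depends on how they are labelled; so \<open>V\<^sup>n\<close> is natural-number valued.
\<close>

definition input_processes :: "(nat \<Rightarrow> (nat \<times> 'x list) pmf) set" where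
  "input_processes = {P. \<forall>n\<ge>1. \<forall>(v, x)\<in>set_pmf (P n). length x = n}"

text \<open>
  The distribution of \<open>(V\<^sup>n, X\<^sup>n, Y\<^sup>n, Z\<^sup>n)\<close>: drawing \<open>(Y\<^sup>n, Z\<^sup>n)\<close> from \<open>W n x\<close>, which does not
  depend on \<open>v\<close>, is the Markov condition.
\<close>

definition markov_joint ::
  "(nat \<Rightarrow> 'x list \<Rightarrow> ('y list \<times> 'z list) pmf) \<Rightarrow> (nat \<Rightarrow> ('v \<times> 'x list) pmf)
    \<Rightarrow> nat \<Rightarrow> ('v \<times> 'x list \<times> 'y list \<times> 'z list) pmf" where
  "markov_joint W P n = do { (v, x) \<leftarrow> P n; (y, z) \<leftarrow> W n x; return_pmf (v, x, y, z) }"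

definition joint_VY ::
  "(nat \<Rightarrow> 'x list \<Rightarrow> ('y list \<times> 'z list) pmf) \<Rightarrow> (nat \<Rightarrow> ('v \<times> 'x list) pmf)
    \<Rightarrow> nat \<Rightarrow> ('v \<times> 'y list) pmf" where
  "joint_VY W P n = map_pmf (\<lambda>(v, x, y, z). (v, y)) (markov_joint W P n)"

definition joint_VZ ::
  "(nat \<Rightarrow> 'x list \<Rightarrow> ('y list \<times> 'z list) pmf) \<Rightarrow> (nat \<Rightarrow> ('v \<times> 'x list) pmf)
    \<Rightarrow> nat \<Rightarrow> ('v \<times> 'z list) pmf" where
  "joint_VZ W P n = map_pmf (\<lambda>(v, x, y, z). (v, z)) (markov_joint W P n)"

text \<open>
  Over infinite alphabets both terms of the difference can be infinite, and \<^typ>\<open>ereal\<close> has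
  \<open>\<infinity> - \<infinity> = \<infinity>\<close>. Such processes have to be left out of the supremum; the value \<open>-\<infinity>\<close> does so.
  Over finite alphabets this case does not arise.
\<close>

definition rate_difference :: "ereal \<Rightarrow> ereal \<Rightarrow> ereal" where
  "rate_difference s t = (if t = \<infinity> then -\<infinity> else s - t)"

end

theory Submission
  imports Defs
begin

text \<open>
  Direct part: for each block length draw \<open>M L\<close> independent codewords \<open>v\<^sub>m\<^sub>l\<close> from the law of \<open>V\<close>, send
  message \<open>m\<close> through a uniformly chosen \<open>v\<^sub>m\<^sub>l\<close> followed by the kernel from \<open>V\<close> to \<open>X\<close>, and decode by
  a threshold on the information density. The expected error is at most
  \<open>Pr(i(V;Y) \<le> r) + M L / b\<^sup>n\<^sup>r\<close>, and by soft covering the expected variational distance between the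
  output law of a message and the law of \<open>Z\<close> is at most \<open>Pr(i(V;Z) > s) + (b\<^sup>n\<^sup>s / L)\<^sup>1\<^sup>/\<^sup>2\<close>. A weighted
  sum of the two selects one codebook that is good for both. With \<open>L\<close> of rate just above \<open>s\<close> the
  variational leakage vanishes, and at bounded message rate this makes all the other metrics vanish.

  Converse: take \<open>V = M\<close>. Vanishing leakage forces \<open>i(M;Z)\<close> to be asymptotically nonpositive in
  probability (at most \<open>\<eta>\<close> for \<open>S6\<close>), and the Verdu-Han bound
  \<open>Pr(i(M;Y) \<le> r) \<le> error + b\<^sup>n\<^sup>r / M\<close> turns the rate into a lower bound on the spectral information rate.
\<close>


subsection \<open>Expectations of bounded functions under discrete distributions\<close>

text \<open>As \<epsilon> is arbitrary, the error must be met up to an additive vanishing term.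
  Choosing the codebook by Markov's inequality would multiply the error by a constant. The leakage
  is therefore added to the error with a weight that tends to infinity, slowly enough for the
  weighted leakage bound to vanish still; the boundedness of the error then forces the leakage
  itself to zero.

  Both directions compare the error sequence with the distribution function of the information
  density up to such a term. All they need of the error constraint is that it survives this
  comparison, so one argument serves both capacities.

  The alphabets may be infinite, so log-likelihood ratios need not be integrable a priori. The
  random coding part works with bounded functions only, by truncation; relative entropy is handled
  through the bound \<open>M\<close> on the likelihood ratio that a uniform message provides.

  At a fixed \<eta>, \<open>S6\<close> leaves a gap of \<eta> between the two directions. It closes
  only in the infimum over \<eta>.\<close>

lemma integrable_measure_pmf_bounded:
  fixes f :: "'a \<Rightarrow> real"
  assumes "\<And>x. x \<in> set_pmf p \<Longrightarrow> \<bar>f x\<bar> \<le> B"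
  shows "integrable (measure_pmf p) f"
  by (rule measure_pmf.integrable_const_bound[where B=B]) (auto simp: AE_measure_pmf_iff assms)

lemma expectation_pmf_mono:
  fixes f g :: "'a \<Rightarrow> real"
  assumes "\<And>x. x \<in> set_pmf p \<Longrightarrow> f x \<le> g x"
    and "\<And>x. \<bar>f x\<bar> \<le> B" and "\<And>x. \<bar>g x\<bar> \<le> C"
  shows "measure_pmf.expectation p f \<le> measure_pmf.expectation p g"
  by (intro integral_mono_AE integrable_measure_pmf_bounded)
     (use assms in \<open>auto simp: AE_measure_pmf_iff\<close>)

lemma expectation_pmf_cong:
  fixes f g :: "'a \<Rightarrow> real"
  assumes "\<And>x. x \<in> set_pmf p \<Longrightarrow> f x = g x"
  shows "measure_pmf.expectation p f = measure_pmf.expectation p g"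
  by (intro integral_cong_AE) (use assms in \<open>auto simp: AE_measure_pmf_iff\<close>)

text \<open>Nonnegative integrals obey the tower rule without integrability. Adding \<open>B\<close>
  makes \<open>f\<close> nonnegative, and the constant cancels because every pmf has total mass
  one.\<close>

lemma expectation_bind_pmf:
  fixes f :: "'b \<Rightarrow> real"
  assumes "\<And>x. \<bar>f x\<bar> \<le> B"
  shows "measure_pmf.expectation (bind_pmf p k) f
    = measure_pmf.expectation p (\<lambda>x. measure_pmf.expectation (k x) f)"
proof -
  define g where "g = (\<lambda>x. f x + B)"
  have g: "0 \<le> g x" "g x \<le> 2 * B" for x using assms[of x] by (auto simp: g_def)
  have ig: "integrable (measure_pmf q) g" for q
    by (rule integrable_measure_pmf_bounded[where B="2*B"]) (use g in auto)
  have iq: "integrable (measure_pmf q) f" for q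
    by (rule integrable_measure_pmf_bounded[where B=B]) (use assms in auto)
  have e: "measure_pmf.expectation q g = measure_pmf.expectation q f + B" for q
    using iq by (simp add: g_def)
  have b: "0 \<le> measure_pmf.expectation q g" "measure_pmf.expectation q g \<le> 2 * B" for q
    using ig g by (auto intro!: integral_nonneg_AE measure_pmf.integral_le_const)
  have i2: "integrable (measure_pmf p) (\<lambda>x. measure_pmf.expectation (k x) g)"
    by (rule integrable_measure_pmf_bounded[where B="2*B"]) (use b in auto)
  have "ennreal (measure_pmf.expectation (bind_pmf p k) g) = (\<integral>\<^sup>+x. g x \<partial>bind_pmf p k)"
    using ig g by (subst nn_integral_eq_integral) auto
  also have "\<dots> = (\<integral>\<^sup>+x. ennreal (measure_pmf.expectation (k x) g) \<partial>measure_pmf p)"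
    using ig g by (simp add: nn_integral_eq_integral)
  also have "\<dots> = ennreal (measure_pmf.expectation p (\<lambda>x. measure_pmf.expectation (k x) g))"
    using i2 b by (subst nn_integral_eq_integral) auto
  finally have "measure_pmf.expectation (bind_pmf p k) g
      = measure_pmf.expectation p (\<lambda>x. measure_pmf.expectation (k x) g)"
    using b by (subst (asm) ennreal_inj) (auto intro!: integral_nonneg_AE)
  moreover have "integrable (measure_pmf p) (\<lambda>x. measure_pmf.expectation (k x) f)"
  proof -
    have "(\<lambda>x. measure_pmf.expectation (k x) f) = (\<lambda>x. measure_pmf.expectation (k x) g - B)"
      by (simp add: e)
    then show ?thesis using i2 by simp
  qed
  ultimately show ?thesis by (simp add: e)
qed

lemma prob_bind_pmf:
  "measure_pmf.prob (bind_pmf p k) A = measure_pmf.expectation p (\<lambda>x. measure_pmf.prob (k x) A)"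
  using expectation_bind_pmf[where f="indicator A :: _ \<Rightarrow> real" and B=1 and p=p and k=k] by simp

text \<open>Fubini for bounded functions: both sides are expectations under one product law, whose
  order of drawing is exchanged by \<open>bind_commute_pmf\<close>.\<close>

lemma expectation_pmf_commute:
  fixes h :: "'a \<Rightarrow> 'b \<Rightarrow> real"
  assumes "\<And>x y. \<bar>h x y\<bar> \<le> B"
  shows "measure_pmf.expectation p (\<lambda>x. measure_pmf.expectation q (h x))
    = measure_pmf.expectation q (\<lambda>y. measure_pmf.expectation p (\<lambda>x. h x y))"
proof -
  have "measure_pmf.expectation p (\<lambda>x. measure_pmf.expectation q (h x)) =
     measure_pmf.expectation (bind_pmf p (\<lambda>x. bind_pmf q (\<lambda>y. return_pmf (x, y)))) (\<lambda>(x, y). h x y)"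
    using assms by (subst expectation_bind_pmf[where B=B], force, subst expectation_bind_pmf[where B=B]) auto
  also have "\<dots> = measure_pmf.expectation q (\<lambda>y. measure_pmf.expectation p (\<lambda>x. h x y))"
    using assms by (subst bind_commute_pmf, subst expectation_bind_pmf[where B=B], force,
        subst expectation_bind_pmf[where B=B]) auto
  finally show ?thesis .
qed

lemma expectation_pair_pmf:
  fixes f :: "'a \<times> 'b \<Rightarrow> real"
  assumes "\<And>x. \<bar>f x\<bar> \<le> B"
  shows "measure_pmf.expectation (pair_pmf p q) f
    = measure_pmf.expectation p (\<lambda>x. measure_pmf.expectation q (\<lambda>y. f (x, y)))"
  unfolding pair_pmf_def
  using assms by (subst expectation_bind_pmf[where B=B], force, subst expectation_bind_pmf[where B=B]) auto

lemma expectation_abs_le_sqrt: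
  fixes f :: "'a \<Rightarrow> real"
  assumes "\<And>x. \<bar>f x\<bar> \<le> B"
  shows "measure_pmf.expectation p (\<lambda>x. \<bar>f x\<bar>) \<le> sqrt (measure_pmf.expectation p (\<lambda>x. (f x)\<^sup>2))"
proof -
  have B: "(f x)\<^sup>2 \<le> B\<^sup>2" for x using assms[of x] by (metis abs_ge_zero power2_abs power_mono)
  have "0 \<le> measure_pmf.variance p (\<lambda>x. \<bar>f x\<bar>)" by simp
  also have "\<dots> = measure_pmf.expectation p (\<lambda>x. (f x)\<^sup>2) - (measure_pmf.expectation p (\<lambda>x. \<bar>f x\<bar>))\<^sup>2"
    using assms B
    by (subst measure_pmf.variance_eq)
      (auto intro: integrable_measure_pmf_bounded[where B=B] integrable_measure_pmf_bounded[where B="B\<^sup>2"])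
  finally show ?thesis by (intro real_le_rsqrt) simp
qed

text \<open>Change of measure. Points outside the support of \<open>P\<close> add nothing on the
  left, so the densities need comparing on the support only.\<close>

lemma prob_le_scaled:
  fixes P Q :: "'a pmf"
  assumes "\<And>w. w \<in> A \<Longrightarrow> w \<in> set_pmf P \<Longrightarrow> pmf P w \<le> c * pmf Q w" and "0 \<le> c"
  shows "measure_pmf.prob P A \<le> c * measure_pmf.prob Q A"
proof -
  have "emeasure P A = (\<integral>\<^sup>+w. ennreal (pmf P w) \<partial>count_space A)" by (simp add: nn_integral_pmf)
  also have "\<dots> \<le> (\<integral>\<^sup>+w. ennreal c * ennreal (pmf Q w) \<partial>count_space A)"
  proof (intro nn_integral_mono)
    fix w assume "w \<in> space (count_space A)"
    then show "ennreal (pmf P w) \<le> ennreal c * ennreal (pmf Q w)"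
      using assms(1)[of w] assms(2)
      by (cases "w \<in> set_pmf P") (auto simp flip: ennreal_mult simp: set_pmf_iff intro!: ennreal_leI)
  qed
  also have "\<dots> = ennreal c * emeasure Q A" by (subst nn_integral_cmult) (auto simp: nn_integral_pmf)
  finally show ?thesis using assms(2)
    by (simp add: measure_pmf.emeasure_eq_measure flip: ennreal_mult)
qed

text \<open>The bound \<open>B\<close> makes the likelihood ratio integrable on \<open>A\<close>.
  Points with \<open>pmf Q z = 0\<close> contribute 0 on the left because division by zero gives 0;
  the intersection with \<open>set_pmf Q\<close> matches this.\<close>

lemma expectation_pmf_ratio:
  fixes P Q :: "'a pmf"
  assumes "0 \<le> B" and "\<And>z. z \<in> A \<Longrightarrow> pmf P z \<le> B * pmf Q z"
  shows "measure_pmf.expectation Q (\<lambda>z. indicator A z * (pmf P z / pmf Q z))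
    = measure_pmf.prob P (A \<inter> set_pmf Q)"
proof -
  have b: "\<bar>indicator A z * (pmf P z / pmf Q z)\<bar> \<le> B" for z
    using assms(1) assms(2)[of z]
    by (cases "pmf Q z = 0") (auto simp: indicator_def abs_of_nonneg pmf_pos pos_divide_le_eq)
  have "ennreal (measure_pmf.expectation Q (\<lambda>z. indicator A z * (pmf P z / pmf Q z)))
      = (\<integral>\<^sup>+z. ennreal (indicator A z * (pmf P z / pmf Q z)) \<partial>Q)"
    using b by (subst nn_integral_eq_integral) (auto intro: integrable_measure_pmf_bounded[where B=B])
  also have "\<dots> = (\<integral>\<^sup>+z. ennreal (pmf Q z) * ennreal (indicator A z * (pmf P z / pmf Q z)) \<partial>count_space UNIV)"
    by (rule nn_integral_measure_pmf)
  also have "\<dots> = (\<integral>\<^sup>+z. ennreal (pmf P z) * indicator (A \<inter> set_pmf Q) z \<partial>count_space UNIV)"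
    by (intro nn_integral_cong) (auto simp: indicator_def set_pmf_iff simp flip: ennreal_mult)
  also have "\<dots> = (\<integral>\<^sup>+z. indicator (A \<inter> set_pmf Q) z \<partial>P)"
    by (rule nn_integral_measure_pmf[symmetric])
  also have "\<dots> = ennreal (measure_pmf.prob P (A \<inter> set_pmf Q))"
    by (simp add: measure_pmf.emeasure_eq_measure)
  finally show ?thesis by (subst (asm) ennreal_inj) (auto intro!: integral_nonneg_AE)
qed

text \<open>Pairwise independence of the random codewords, all that the variance bound and the union
  bound use. Coordinate \<open>i\<close> is split off the product; \<open>j\<close> is then a
  coordinate of the independent rest.\<close>

lemma Pi_pmf_two_components:
  assumes "finite I" and "i \<in> I" and "j \<in> I" and "i \<noteq> j"
  shows "map_pmf (\<lambda>c. (c i, c j)) (Pi_pmf I d (\<lambda>_. p)) = pair_pmf p p"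
proof -
  define I' where "I' = I - {i}"
  have I: "I = insert i I'" "i \<notin> I'" "finite I'" "j \<in> I'" using assms by (auto simp: I'_def)
  have "map_pmf (\<lambda>c. (c i, c j)) (Pi_pmf I d (\<lambda>_. p))
      = map_pmf (\<lambda>(v, c). (v, c j)) (pair_pmf p (Pi_pmf I' d (\<lambda>_. p)))"
    using I assms(4) by (subst I(1), subst Pi_pmf_insert)
       (auto simp: pmf.map_comp o_def case_prod_unfold)
  also have "\<dots> = pair_pmf p (map_pmf (\<lambda>c. c j) (Pi_pmf I' d (\<lambda>_. p)))"
    by (simp add: pair_map_pmf2 apsnd_def map_prod_def)
  also have "map_pmf (\<lambda>c. c j) (Pi_pmf I' d (\<lambda>_. p)) = p"
    using I by (subst Pi_pmf_component) auto
  finally show ?thesis .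
qed

lemma expectation_Pi_pmf_component:
  fixes f :: "'v \<Rightarrow> real"
  assumes "finite I" and "i \<in> I"
  shows "measure_pmf.expectation (Pi_pmf I d (\<lambda>_. p)) (\<lambda>c. f (c i)) = measure_pmf.expectation p f"
proof -
  have "measure_pmf.expectation (map_pmf (\<lambda>c. c i) (Pi_pmf I d (\<lambda>_. p))) f = measure_pmf.expectation p f"
    using assms by (subst Pi_pmf_component) auto
  then show ?thesis by simp
qed

lemma expectation_Pi_pmf_two_components:
  fixes f :: "'v \<Rightarrow> 'v \<Rightarrow> real"
  assumes "finite I" and "i \<in> I" and "j \<in> I" and "i \<noteq> j" and "\<And>v w. \<bar>f v w\<bar> \<le> B"
  shows "measure_pmf.expectation (Pi_pmf I d (\<lambda>_. p)) (\<lambda>c. f (c i) (c j))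
    = measure_pmf.expectation p (\<lambda>v. measure_pmf.expectation p (f v))"
proof -
  have "measure_pmf.expectation (map_pmf (\<lambda>c. (c i, c j)) (Pi_pmf I d (\<lambda>_. p))) (\<lambda>(v, w). f v w)
      = measure_pmf.expectation (pair_pmf p p) (\<lambda>(v, w). f v w)"
    using assms by (subst Pi_pmf_two_components) auto
  also have "\<dots> = measure_pmf.expectation p (\<lambda>v. measure_pmf.expectation p (f v))"
    using assms(5) by (subst expectation_pair_pmf[where B=B]) auto
  finally show ?thesis by simp
qed


subsection \<open>Soft covering\<close>

text \<open>The probabilistic method. The selected point lies in the support, which later guarantees
  that every codeword has positive probability and that conditioning on it is meaningful.\<close>

lemma exists_le_expectation:
  fixes f :: "'a \<Rightarrow> real"
  assumes "\<And>x. \<bar>f x\<bar> \<le> B"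
  shows "\<exists>x\<in>set_pmf p. f x \<le> measure_pmf.expectation p f"
proof (rule ccontr)
  assume "\<not> ?thesis"
  then have "measure_pmf.expectation p f < measure_pmf.expectation p f"
    by (intro measure_pmf.expectation_greater integrable_measure_pmf_bounded[where B=B])
       (use assms in \<open>auto simp: AE_measure_pmf_iff not_le\<close>)
  then show False by simp
qed

text \<open>Normal form of all joint laws below: (V,X), (V,Y), (V,Z) and (M,Z) are each an input law
  followed by a kernel. The likelihood ratio to the product of the marginals is then
  \<open>pmf (U v) u / pmf (bind_pmf p U) u\<close> on the support.\<close>

definition joint_pmf :: "'v pmf \<Rightarrow> ('v \<Rightarrow> 'u pmf) \<Rightarrow> ('v \<times> 'u) pmf" where
  "joint_pmf p U = bind_pmf p (\<lambda>v. map_pmf (Pair v) (U v))"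

lemma prob_joint_pmf:
  "measure_pmf.prob (joint_pmf p U) A = measure_pmf.expectation p (\<lambda>v. measure_pmf.prob (U v) {u. (v, u) \<in> A})"
  unfolding joint_pmf_def prob_bind_pmf by (simp add: vimage_def)

lemma average_abs_le:
  fixes f :: "'i \<Rightarrow> real"
  assumes "\<And>l. l \<in> S \<Longrightarrow> \<bar>f l\<bar> \<le> B" and "0 \<le> B"
  shows "\<bar>(\<Sum>l\<in>S. f l) / card S\<bar> \<le> B"
proof (cases "card S = 0")
  case False
  have "\<bar>\<Sum>l\<in>S. f l\<bar> \<le> (\<Sum>l\<in>S. B)"
    by (rule order_trans[OF sum_abs]) (intro sum_mono assms)
  then show ?thesis using False by (simp add: field_simps)
qed (use assms in auto)

text \<open>Cross terms vanish by independence, so the variance of the average is at most the second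
  moment of \<open>f\<close> over \<open>card S\<close>. Since \<open>f\<close> is at most \<tau>
  with mean at most 1, that moment is at most \<tau> rather than its square. This is why a number of
  codewords of rate just above that of \<tau> is enough.\<close>

lemma expectation_iid_mean_deviation:
  fixes f :: "'v \<Rightarrow> real"
  assumes "finite I" and "S \<subseteq> I" and "S \<noteq> {}"
    and f: "\<And>v. 0 \<le> f v" "\<And>v. f v \<le> \<tau>" and "measure_pmf.expectation p f \<le> 1"
  shows "measure_pmf.expectation (Pi_pmf I d (\<lambda>_. p))
      (\<lambda>c. \<bar>(\<Sum>l\<in>S. f (c l)) / card S - measure_pmf.expectation p f\<bar>) \<le> sqrt (\<tau> / card S)"
proof -
  define \<mu> where "\<mu> = measure_pmf.expectation p f"
  define g where "g v = f v - \<mu>" for v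
  let ?C = "Pi_pmf I d (\<lambda>_. p)"
  have finS: "finite S" using assms finite_subset by blast
  have cS: "real (card S) > 0" using finS assms(3) by (simp add: card_gt_0_iff)
  have \<tau>: "0 \<le> \<tau>" using f[of undefined] by linarith
  have fa: "\<bar>f v\<bar> \<le> \<tau>" for v using f[of v] by simp
  have intf: "integrable (measure_pmf p) f" by (rule integrable_measure_pmf_bounded[where B=\<tau>]) (rule fa)
  have \<mu>: "0 \<le> \<mu>" "\<mu> \<le> \<tau>" "\<mu> \<le> 1"
    unfolding \<mu>_def using f assms(6) intf by (auto intro!: integral_nonneg_AE measure_pmf.integral_le_const)
  have ga: "\<bar>g v\<bar> \<le> \<tau>" for v unfolding g_def using f[of v] \<mu> by (auto simp: abs_le_iff)
  have gg: "\<bar>g v * g w\<bar> \<le> \<tau> * \<tau>" for v w unfolding abs_mult by (intro mult_mono ga) (use \<tau> in auto)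
  have g0: "measure_pmf.expectation p g = 0" using intf by (simp add: g_def[abs_def] \<mu>_def)
  have g2: "measure_pmf.expectation p (\<lambda>v. g v * g v) \<le> \<tau>"
  proof -
    have ff: "integrable (measure_pmf p) (\<lambda>v. f v * f v)"
      by (rule integrable_measure_pmf_bounded[where B="\<tau>*\<tau>"])
        (metis abs_mult fa mult_mono abs_ge_zero \<tau>)
    have "measure_pmf.expectation p (\<lambda>v. g v * g v) = measure_pmf.expectation p (\<lambda>v. f v * f v - 2 * \<mu> * f v + \<mu> * \<mu>)"
      by (intro arg_cong[where f="measure_pmf.expectation p"] ext) (simp add: g_def algebra_simps)
    also have "\<dots> = measure_pmf.expectation p (\<lambda>v. f v * f v) - \<mu> * \<mu>"
      using ff intf by (simp add: \<mu>_def[symmetric])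
    also have "\<dots> \<le> measure_pmf.expectation p (\<lambda>v. f v * f v)" using \<mu> by simp
    also have "\<dots> \<le> measure_pmf.expectation p (\<lambda>v. \<tau> * f v)"
      using f by (intro integral_mono ff integrable_mult_right intf) (auto intro: mult_right_mono)
    also have "\<dots> = \<tau> * \<mu>" by (simp add: \<mu>_def)
    also have "\<dots> \<le> \<tau> * 1" using \<mu> \<tau> by (intro mult_left_mono) auto
    finally show ?thesis by simp
  qed
  define h where "h c = (\<Sum>l\<in>S. f (c l)) / card S - \<mu>" for c :: "'a \<Rightarrow> 'v"
  have h_eq: "h c = (\<Sum>l\<in>S. g (c l)) / card S" for c
    using cS by (simp add: h_def g_def sum_subtractf field_simps)
  have ha: "\<bar>h c\<bar> \<le> \<tau>" for c unfolding h_eq by (rule average_abs_le) (use ga \<tau> in auto)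
  have int2: "integrable (measure_pmf ?C) (\<lambda>c. g (c l) * g (c k))" for l k
    by (rule integrable_measure_pmf_bounded[where B="\<tau>*\<tau>"]) (rule gg)
  have pair: "measure_pmf.expectation ?C (\<lambda>c. g (c l) * g (c k)) \<le> (if l = k then \<tau> else 0)"
    if "l \<in> S" "k \<in> S" for l k
  proof (cases "l = k")
    case True
    with that assms g2 show ?thesis
      using expectation_Pi_pmf_component[where f="\<lambda>v. g v * g v" and I=I and i=k and d=d and p=p] by auto
  next
    case False
    have "measure_pmf.expectation ?C (\<lambda>c. g (c l) * g (c k))
        = measure_pmf.expectation p (\<lambda>v. measure_pmf.expectation p (\<lambda>w. g v * g w))"
      using that assms(1,2) False
      by (intro expectation_Pi_pmf_two_components[where B="\<tau>*\<tau>"] gg) auto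
    then show ?thesis using False g0 by simp
  qed
  have "measure_pmf.expectation ?C (\<lambda>c. (h c)\<^sup>2)
      = measure_pmf.expectation ?C (\<lambda>c. (\<Sum>l\<in>S. \<Sum>k\<in>S. g (c l) * g (c k)) / (real (card S) * real (card S)))"
    by (intro arg_cong[where f="measure_pmf.expectation ?C"] ext)
       (simp add: h_eq power2_eq_square sum_product)
  also have "\<dots> = (\<Sum>l\<in>S. \<Sum>k\<in>S. measure_pmf.expectation ?C (\<lambda>c. g (c l) * g (c k))) / (real (card S) * real (card S))"
    using int2 by (simp add: Bochner_Integration.integral_sum)
  also have "\<dots> \<le> (\<Sum>l\<in>S. \<Sum>k\<in>S. (if l = k then \<tau> else 0)) / (real (card S) * real (card S))"
    by (intro divide_right_mono sum_mono pair) auto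
  also have "\<dots> = \<tau> / card S" using finS cS by simp
  finally have var: "measure_pmf.expectation ?C (\<lambda>c. (h c)\<^sup>2) \<le> \<tau> / card S" .
  have "measure_pmf.expectation ?C (\<lambda>c. \<bar>h c\<bar>) \<le> sqrt (measure_pmf.expectation ?C (\<lambda>c. (h c)\<^sup>2))"
    by (rule expectation_abs_le_sqrt) (rule ha)
  also have "\<dots> \<le> sqrt (\<tau> / card S)" using var by simp
  finally show ?thesis unfolding h_def \<mu>_def .
qed

text \<open>The cutoff bounds the variance of codeword averages. The mass it removes is the
  probability that the likelihood ratio exceeds \<tau>, which becomes the tail of the information
  density.\<close>

definition truncated_density :: "'v pmf \<Rightarrow> ('v \<Rightarrow> 'u pmf) \<Rightarrow> real \<Rightarrow> 'v \<Rightarrow> 'u \<Rightarrow> real" where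
  "truncated_density p U \<tau> v u =
     indicator {u. pmf (U v) u \<le> \<tau> * pmf (bind_pmf p U) u} u * (pmf (U v) u / pmf (bind_pmf p U) u)"

text \<open>An upper bound on the variational deficit of the code output that mentions no event, so
  it is a bounded function of the codebook alone and can be averaged over random codebooks. The set
  \<open>S\<close> indexes the codewords of one message.\<close>

definition covering_defect ::
  "'v pmf \<Rightarrow> ('v \<Rightarrow> 'u pmf) \<Rightarrow> real \<Rightarrow> 'i set \<Rightarrow> ('i \<Rightarrow> 'v) \<Rightarrow> real" where
  "covering_defect p U \<tau> S c = measure_pmf.expectation (bind_pmf p U)
     (\<lambda>u. max 0 (1 - (\<Sum>l\<in>S. truncated_density p U \<tau> (c l) u) / card S))"

lemma truncated_density_bounds:
  assumes "0 \<le> \<tau>"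
  shows "0 \<le> truncated_density p U \<tau> v u" "truncated_density p U \<tau> v u \<le> \<tau>"
proof -
  show "0 \<le> truncated_density p U \<tau> v u" by (simp add: truncated_density_def)
  show "truncated_density p U \<tau> v u \<le> \<tau>"
    using assms by (cases "pmf (bind_pmf p U) u = 0")
      (auto simp: truncated_density_def indicator_def pos_divide_le_eq pmf_pos)
qed

lemma covering_defect_bounds:
  assumes "0 \<le> \<tau>"
  shows "0 \<le> covering_defect p U \<tau> S c" "covering_defect p U \<tau> S c \<le> 1"
    "\<bar>max 0 (1 - (\<Sum>l\<in>S. truncated_density p U \<tau> (c l) u) / card S)\<bar> \<le> 1"
proof -
  have b: "\<bar>max 0 (1 - (\<Sum>l\<in>S. truncated_density p U \<tau> (c l) u) / card S)\<bar> \<le> 1" for u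
    using truncated_density_bounds(1)[OF assms] by (auto simp: max_def intro!: divide_nonneg_nonneg sum_nonneg)
  show "\<bar>max 0 (1 - (\<Sum>l\<in>S. truncated_density p U \<tau> (c l) u) / card S)\<bar> \<le> 1" by (rule b)
  have i: "integrable (measure_pmf (bind_pmf p U))
     (\<lambda>u. max 0 (1 - (\<Sum>l\<in>S. truncated_density p U \<tau> (c l) u) / card S))"
    by (rule integrable_measure_pmf_bounded[where B=1]) (rule b)
  show "0 \<le> covering_defect p U \<tau> S c"
    unfolding covering_defect_def by (intro integral_nonneg_AE) auto
  show "covering_defect p U \<tau> S c \<le> 1"
    unfolding covering_defect_def using b by (intro measure_pmf.integral_le_const i) (auto simp: abs_le_iff)
qed

text \<open>
  Both sides are probability measures, so it is enough to bound the deficit of the code output;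
  discarding the part of the density above \<open>\<tau>\<close> only increases it.
\<close>
lemma output_deviation_le_covering_defect:
  assumes "finite S" and "S \<noteq> {}" and "0 \<le> \<tau>"
  shows "\<bar>(\<Sum>l\<in>S. measure_pmf.prob (U (c l)) A) / card S - measure_pmf.prob (bind_pmf p U) A\<bar>
    \<le> covering_defect p U \<tau> S c"
proof -
  define q where "q = bind_pmf p U"
  define t where "t = truncated_density p U \<tau>"
  have cS: "real (card S) > 0" using assms by (simp add: card_gt_0_iff)
  have tb: "0 \<le> t v u" "t v u \<le> \<tau>" for v u by (simp_all add: t_def truncated_density_bounds[OF assms(3)])
  have deficit: "measure_pmf.prob q A - (\<Sum>l\<in>S. measure_pmf.prob (U (c l)) A) / card S \<le> covering_defect p U \<tau> S c"
    for A
  proof -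
    have i: "integrable (measure_pmf q) (\<lambda>u. indicator A u * t v u)" for v
      by (rule integrable_measure_pmf_bounded[where B=\<tau>]) (use tb assms(3) in \<open>auto simp: indicator_def\<close>)
    have e: "measure_pmf.expectation q (\<lambda>u. indicator A u * t v u) \<le> measure_pmf.prob (U v) A" for v
    proof -
      have "measure_pmf.expectation q (\<lambda>u. indicator A u * t v u)
        = measure_pmf.expectation q (\<lambda>u. indicator (A \<inter> {u. pmf (U v) u \<le> \<tau> * pmf q u}) u * (pmf (U v) u / pmf q u))"
        by (intro arg_cong[where f="measure_pmf.expectation q"] ext)
           (auto simp: t_def truncated_density_def q_def indicator_def)
      also have "\<dots> = measure_pmf.prob (U v) (A \<inter> {u. pmf (U v) u \<le> \<tau> * pmf q u} \<inter> set_pmf q)"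
        by (rule expectation_pmf_ratio[OF assms(3)]) auto
      also have "\<dots> \<le> measure_pmf.prob (U v) A" by (rule measure_pmf.finite_measure_mono) auto
      finally show ?thesis .
    qed
    have "measure_pmf.prob q A - (\<Sum>l\<in>S. measure_pmf.prob (U (c l)) A) / card S
      \<le> measure_pmf.prob q A - (\<Sum>l\<in>S. measure_pmf.expectation q (\<lambda>u. indicator A u * t (c l) u)) / card S"
      using cS by (intro diff_left_mono divide_right_mono sum_mono e) auto
    also have "\<dots> = measure_pmf.expectation q (\<lambda>u. indicator A u - (\<Sum>l\<in>S. indicator A u * t (c l) u) / card S)"
      by (subst Bochner_Integration.integral_diff) (auto simp: i Bochner_Integration.integral_sum[OF i]
          intro!: integrable_divide Bochner_Integration.integrable_sum
            integrable_measure_pmf_bounded[where B=1 and f="indicator A"])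
    also have "\<dots> \<le> covering_defect p U \<tau> S c"
      unfolding covering_defect_def q_def[symmetric] t_def[symmetric]
    proof (rule expectation_pmf_mono[where B="1+\<tau>" and C=1])
      fix u
      show "indicator A u - (\<Sum>l\<in>S. indicator A u * t (c l) u) / real (card S)
          \<le> max 0 (1 - (\<Sum>l\<in>S. t (c l) u) / real (card S))"
        by (auto simp: indicator_def)
      show "\<bar>max 0 (1 - (\<Sum>l\<in>S. t (c l) u) / real (card S))\<bar> \<le> 1"
        unfolding t_def by (rule covering_defect_bounds[OF assms(3)])
      have "\<bar>(\<Sum>l\<in>S. indicator A u * t (c l) u) / real (card S)\<bar> \<le> \<tau>"
        by (rule average_abs_le) (use tb assms(3) in \<open>auto simp: indicator_def\<close>)
      moreover have "\<bar>indicator A u :: real\<bar> \<le> 1" by (simp add: indicator_def)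
      ultimately show "\<bar>indicator A u - (\<Sum>l\<in>S. indicator A u * t (c l) u) / real (card S)\<bar> \<le> 1 + \<tau>"
        by linarith
    qed
    finally show ?thesis .
  qed
  have compl: "measure_pmf.prob r (- A) = 1 - measure_pmf.prob r A" for r :: "'b pmf"
    using measure_pmf.prob_compl[of A r] by (simp add: Compl_eq_Diff_UNIV)
  have "(\<Sum>l\<in>S. measure_pmf.prob (U (c l)) (-A)) / card S = 1 - (\<Sum>l\<in>S. measure_pmf.prob (U (c l)) A) / card S"
    using cS by (simp add: compl sum_subtractf field_simps)
  with deficit[of A] deficit[of "- A"] show ?thesis
    by (simp add: compl q_def abs_le_iff)
qed

text \<open>Fubini fixes the output \<open>u\<close> and averages over the codebook. The mean of the
  truncated ratios at \<open>u\<close> deviates from its expectation \<open>\<mu> u\<close> by at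
  most the square root term on average, and \<open>1 - \<mu> u\<close> averaged over the output law
  is the mass lost by truncation.\<close>

lemma expectation_covering_defect:
  fixes p :: "'v pmf" and U :: "'v \<Rightarrow> 'u pmf"
  assumes "finite I" and "S \<subseteq> I" and "S \<noteq> {}" and "0 \<le> \<tau>"
  shows "measure_pmf.expectation (Pi_pmf I d (\<lambda>_. p)) (covering_defect p U \<tau> S)
    \<le> measure_pmf.prob (joint_pmf p U) {(v, u). \<tau> * pmf (bind_pmf p U) u < pmf (U v) u} + sqrt (\<tau> / card S)"
proof -
  define q where "q = bind_pmf p U"
  define t where "t = truncated_density p U \<tau>"
  define \<mu> where "\<mu> u = measure_pmf.expectation p (\<lambda>v. t v u)" for u
  let ?C = "Pi_pmf I d (\<lambda>_. p)"
  have tb: "0 \<le> t v u" "t v u \<le> \<tau>" for v u by (simp_all add: t_def truncated_density_bounds[OF assms(4)])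
  have ta: "\<bar>t v u\<bar> \<le> \<tau>" for v u using tb[of v u] by simp
  have int: "integrable (measure_pmf p) (\<lambda>v. t v u)" for u
    by (rule integrable_measure_pmf_bounded[where B=\<tau>]) (rule ta)
  have mu: "0 \<le> \<mu> u" "\<mu> u \<le> \<tau>" for u
    unfolding \<mu>_def using tb int by (auto intro!: integral_nonneg_AE measure_pmf.integral_le_const)
  \<comment> \<open>Before truncation the ratio averages to exactly 1 under \<open>p\<close>, by
    definition of the output law; truncation only lowers it.\<close>
  have mu1: "\<mu> u \<le> 1" for u
  proof (cases "pmf q u = 0")
    case True
    then show ?thesis by (simp add: \<mu>_def t_def truncated_density_def q_def)
  next
    case False
    then have pos: "pmf q u > 0" by (simp add: pmf_pos)
    have "\<mu> u \<le> measure_pmf.expectation p (\<lambda>v. pmf (U v) u / pmf q u)"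
      unfolding \<mu>_def
      by (rule expectation_pmf_mono[where B=\<tau> and C="1 / pmf q u"])
        (use ta pos in \<open>auto simp: t_def truncated_density_def q_def indicator_def pmf_le_1 intro!: divide_right_mono\<close>)
    also have "\<dots> = 1" using pos by (simp add: q_def pmf_bind)
    finally show ?thesis .
  qed
  have cd: "\<bar>max 0 (1 - (\<Sum>l\<in>S. t (c l) u) / real (card S))\<bar> \<le> 1" for c u
    unfolding t_def by (rule covering_defect_bounds[OF assms(4)])
  have ha: "\<bar>(\<Sum>l\<in>S. t (c l) u) / card S\<bar> \<le> \<tau>" for c u
    by (rule average_abs_le) (use ta assms(4) in auto)
  have pointwise: "measure_pmf.expectation ?C (\<lambda>c. max 0 (1 - (\<Sum>l\<in>S. t (c l) u) / card S))
     \<le> 1 - \<mu> u + sqrt (\<tau> / card S)" for u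
  proof -
    have bd: "\<bar>(\<Sum>l\<in>S. t (c l) u) / card S - \<mu> u\<bar> \<le> \<tau> + \<tau>" for c
      using ha[of c u] mu[of u] by linarith
    have bd1: "\<bar>1 - \<mu> u + \<bar>(\<Sum>l\<in>S. t (c l) u) / card S - \<mu> u\<bar>\<bar> \<le> 1 + \<tau> + \<tau>" for c
      using bd[of c] mu1[of u] mu[of u] by linarith
    have ii: "integrable (measure_pmf ?C) (\<lambda>c. \<bar>(\<Sum>l\<in>S. t (c l) u) / card S - \<mu> u\<bar>)"
      by (rule integrable_measure_pmf_bounded[where B="\<tau>+\<tau>"]) (use bd in simp)
    \<comment> \<open>Replacing the positive part is legitimate because
      \<open>\<mu> u \<le> 1\<close> keeps the new integrand nonnegative.\<close>
    have "measure_pmf.expectation ?C (\<lambda>c. max 0 (1 - (\<Sum>l\<in>S. t (c l) u) / card S))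
       \<le> measure_pmf.expectation ?C (\<lambda>c. 1 - \<mu> u + \<bar>(\<Sum>l\<in>S. t (c l) u) / card S - \<mu> u\<bar>)"
      by (rule expectation_pmf_mono[OF _ cd bd1]) (use mu1[of u] in \<open>auto simp: abs_if\<close>)
    also have "\<dots> = 1 - \<mu> u + measure_pmf.expectation ?C (\<lambda>c. \<bar>(\<Sum>l\<in>S. t (c l) u) / card S - \<mu> u\<bar>)"
      using ii by simp
    also have "\<dots> \<le> 1 - \<mu> u + sqrt (\<tau> / card S)"
      unfolding \<mu>_def
      by (intro add_left_mono expectation_iid_mean_deviation assms(1-3) tb)
         (use mu1 in \<open>simp add: \<mu>_def\<close>)
    finally show ?thesis .
  qed
  have mass: "measure_pmf.expectation q (t v) = 1 - measure_pmf.prob (U v) {u. \<tau> * pmf q u < pmf (U v) u}"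
    if "v \<in> set_pmf p" for v
  proof -
    have "measure_pmf.expectation q (t v)
      = measure_pmf.expectation q (\<lambda>u. indicator {u. pmf (U v) u \<le> \<tau> * pmf q u} u * (pmf (U v) u / pmf q u))"
      by (simp add: t_def truncated_density_def[abs_def] q_def)
    also have "\<dots> = measure_pmf.prob (U v) ({u. pmf (U v) u \<le> \<tau> * pmf q u} \<inter> set_pmf q)"
      by (rule expectation_pmf_ratio[OF assms(4)]) auto
    also have "\<dots> = measure_pmf.prob (U v) (UNIV - {u. \<tau> * pmf q u < pmf (U v) u})"
      by (rule measure_pmf.finite_measure_eq_AE) (use that in \<open>auto simp: AE_measure_pmf_iff q_def not_less\<close>)
    also have "\<dots> = 1 - measure_pmf.prob (U v) {u. \<tau> * pmf q u < pmf (U v) u}"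
      using measure_pmf.prob_compl[of "{u. \<tau> * pmf q u < pmf (U v) u}" "U v"] by simp
    finally show ?thesis .
  qed
  have intmu: "integrable (measure_pmf q) \<mu>"
    by (rule integrable_measure_pmf_bounded[where B=\<tau>]) (use mu in auto)
  have "measure_pmf.expectation q \<mu> = measure_pmf.expectation p (\<lambda>v. measure_pmf.expectation q (t v))"
    unfolding \<mu>_def by (rule expectation_pmf_commute[where B=\<tau>]) (rule ta)
  also have "\<dots> = measure_pmf.expectation p (\<lambda>v. 1 - measure_pmf.prob (U v) {u. \<tau> * pmf q u < pmf (U v) u})"
    by (rule expectation_pmf_cong) (rule mass)
  also have "\<dots> = 1 - measure_pmf.prob (joint_pmf p U) {(v, u). \<tau> * pmf q u < pmf (U v) u}"
    by (simp add: prob_joint_pmf integrable_measure_pmf_bounded[where B=1])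
  finally have emu: "measure_pmf.expectation q \<mu>
     = 1 - measure_pmf.prob (joint_pmf p U) {(v, u). \<tau> * pmf q u < pmf (U v) u}" .
  have "measure_pmf.expectation ?C (covering_defect p U \<tau> S)
      = measure_pmf.expectation q (\<lambda>u. measure_pmf.expectation ?C (\<lambda>c. max 0 (1 - (\<Sum>l\<in>S. t (c l) u) / card S)))"
    unfolding covering_defect_def[abs_def] q_def[symmetric] t_def[symmetric]
    by (rule expectation_pmf_commute) (rule cd)
  also have "\<dots> \<le> measure_pmf.expectation q (\<lambda>u. 1 - \<mu> u + sqrt (\<tau> / card S))"
  proof (rule integral_mono)
    show "integrable (measure_pmf q) (\<lambda>u. measure_pmf.expectation ?C (\<lambda>c. max 0 (1 - (\<Sum>l\<in>S. t (c l) u) / card S)))"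
    proof (rule integrable_measure_pmf_bounded[where B=1])
      fix u
      have "measure_pmf.expectation ?C (\<lambda>c. max 0 (1 - (\<Sum>l\<in>S. t (c l) u) / card S)) \<le> 1"
        by (intro measure_pmf.integral_le_const integrable_measure_pmf_bounded[where B=1] cd) (use cd in \<open>auto simp: abs_le_iff\<close>)
      moreover have "0 \<le> measure_pmf.expectation ?C (\<lambda>c. max 0 (1 - (\<Sum>l\<in>S. t (c l) u) / card S))"
        by (intro integral_nonneg_AE) auto
      ultimately show "\<bar>measure_pmf.expectation ?C (\<lambda>c. max 0 (1 - (\<Sum>l\<in>S. t (c l) u) / card S))\<bar> \<le> 1" by simp
    qed
  qed (use intmu pointwise in auto)
  also have "\<dots> = 1 - measure_pmf.expectation q \<mu> + sqrt (\<tau> / card S)" using intmu by simp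
  finally show ?thesis using emu by (simp add: q_def)
qed


subsection \<open>Random coding and divergences between discrete distributions\<close>

text \<open>The alternative \<open>m = M\<close> makes the set nonempty and bounds its least
  element, so \<open>M\<close> is the answer when no codeword passes the threshold.\<close>

definition threshold_decoder ::
  "('v \<Rightarrow> 'u pmf) \<Rightarrow> 'u pmf \<Rightarrow> real \<Rightarrow> nat \<Rightarrow> nat \<Rightarrow> (nat \<times> nat \<Rightarrow> 'v) \<Rightarrow> 'u \<Rightarrow> nat" where
  "threshold_decoder U q \<theta> M L c u =
     (LEAST m. m = M \<or> 1 \<le> m \<and> (\<exists>l\<in>{1..L}. \<theta> * pmf q u < pmf (U (c (m, l))) u))"

lemma threshold_decoder_range:
  assumes "1 \<le> M"
  shows "threshold_decoder U q \<theta> M L c u \<in> {1..M}"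
proof -
  let ?P = "\<lambda>m. m = M \<or> 1 \<le> m \<and> (\<exists>l\<in>{1..L}. \<theta> * pmf q u < pmf (U (c (m, l))) u)"
  have "?P (LEAST m. ?P m)" by (rule LeastI[of ?P M]) simp
  moreover have "(LEAST m. ?P m) \<le> M" by (rule Least_le) simp
  ultimately show ?thesis using assms unfolding threshold_decoder_def by auto
qed

text \<open>If the sent codeword is the only one to pass, the least candidate is its message. Other
  codewords of the same message count as competitors too; this overcount is still covered by the
  term \<open>M L / \<theta>\<close> of the error bound.\<close>

lemma threshold_decoder_error:
  assumes "(m, l) \<in> {1..M} \<times> {1..L}"
  shows "{u. threshold_decoder U q \<theta> M L c u \<noteq> m} \<subseteq>
    {u. pmf (U (c (m, l))) u \<le> \<theta> * pmf q u} \<union>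
    (\<Union>j\<in>{1..M} \<times> {1..L} - {(m, l)}. {u. \<theta> * pmf q u < pmf (U (c j)) u})"
proof
  fix u assume "u \<in> {u. threshold_decoder U q \<theta> M L c u \<noteq> m}"
  then have ne: "threshold_decoder U q \<theta> M L c u \<noteq> m" by simp
  show "u \<in> {u. pmf (U (c (m, l))) u \<le> \<theta> * pmf q u} \<union>
    (\<Union>j\<in>{1..M} \<times> {1..L} - {(m, l)}. {u. \<theta> * pmf q u < pmf (U (c j)) u})"
  proof (rule ccontr)
    assume "\<not> ?thesis"
    then have hit: "\<theta> * pmf q u < pmf (U (c (m, l))) u"
      and miss: "\<And>k l'. k \<in> {1..M} \<Longrightarrow> l' \<in> {1..L} \<Longrightarrow> (k, l') \<noteq> (m, l) \<Longrightarrow> \<not> \<theta> * pmf q u < pmf (U (c (k, l'))) u"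
      by auto
    have "threshold_decoder U q \<theta> M L c u = m"
      unfolding threshold_decoder_def
    proof (rule Least_equality)
      show "m = M \<or> 1 \<le> m \<and> (\<exists>l\<in>{1..L}. \<theta> * pmf q u < pmf (U (c (m, l))) u)"
        using hit assms by auto
    next
      fix k assume k: "k = M \<or> 1 \<le> k \<and> (\<exists>l\<in>{1..L}. \<theta> * pmf q u < pmf (U (c (k, l))) u)"
      show "m \<le> k"
      proof (cases "k < M")
        case True
        then obtain l' where "l' \<in> {1..L}" "\<theta> * pmf q u < pmf (U (c (k, l'))) u" "1 \<le> k" using k by auto
        then show ?thesis using miss[of k l'] True by force
      qed (use assms in auto)
    qed
    then show False using ne by simp
  qed
qed

text \<open>Union bound over the competing codewords. Each is independent of the sent one, hence of
  the output, and an output drawn from \<open>q\<close> passes the threshold of a fixed codeword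
  with probability at most \<open>1 / \<theta>\<close>.\<close>

lemma expectation_decoding_error:
  fixes p :: "'v pmf" and U :: "'v \<Rightarrow> 'u pmf"
  assumes "0 < \<theta>" and i: "i \<in> {1..M} \<times> {1..L}"
  shows "measure_pmf.expectation (Pi_pmf ({1..M} \<times> {1..L}) d (\<lambda>_. p))
      (\<lambda>c. measure_pmf.prob (U (c i)) {u. threshold_decoder U (bind_pmf p U) \<theta> M L c u \<noteq> fst i})
    \<le> measure_pmf.prob (joint_pmf p U) {(v, u). pmf (U v) u \<le> \<theta> * pmf (bind_pmf p U) u} + real M * real L / \<theta>"
proof -
  define q where "q = bind_pmf p U"
  define I where "I = {1..M} \<times> {1..L}"
  let ?C = "Pi_pmf I d (\<lambda>_. p)"
  let ?A = "\<lambda>v. measure_pmf.prob (U v) {u. pmf (U v) u \<le> \<theta> * pmf q u}"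
  let ?B = "\<lambda>v w. measure_pmf.prob (U v) {u. \<theta> * pmf q u < pmf (U w) u}"
  have finI: "finite I" and cI: "card I = M * L" and iI: "i \<in> I" using i by (auto simp: I_def)
  have ib: "integrable (measure_pmf r) (\<lambda>c. measure_pmf.prob (f c) (g c))" for r f g
    by (rule integrable_measure_pmf_bounded[where B=1]) auto
  have two: "measure_pmf.expectation ?C (\<lambda>c. ?B (c i) (c j)) \<le> 1 / \<theta>" if "j \<in> I - {i}" for j
  proof -
    have "measure_pmf.expectation ?C (\<lambda>c. ?B (c i) (c j))
       = measure_pmf.expectation p (\<lambda>v. measure_pmf.expectation p (\<lambda>w. ?B v w))"
      using that iI by (intro expectation_Pi_pmf_two_components[where B=1] finI) auto
    \<comment> \<open>Averaging over the sent codeword first turns \<open>U v\<close> into the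
      output law \<open>q\<close>.\<close>
    also have "\<dots> = measure_pmf.expectation p (\<lambda>w. measure_pmf.expectation p (\<lambda>v. ?B v w))"
      by (rule expectation_pmf_commute[where B=1]) auto
    also have "\<dots> = measure_pmf.expectation p (\<lambda>w. measure_pmf.prob q {u. \<theta> * pmf q u < pmf (U w) u})"
      by (simp add: q_def prob_bind_pmf)
    also have "\<dots> \<le> 1 / \<theta>"
    proof (intro measure_pmf.integral_le_const ib AE_pmfI)
      fix w
      have "measure_pmf.prob q {u. \<theta> * pmf q u < pmf (U w) u}
          \<le> 1 / \<theta> * measure_pmf.prob (U w) {u. \<theta> * pmf q u < pmf (U w) u}"
        by (rule prob_le_scaled) (use assms(1) in \<open>auto simp: field_simps\<close>)
      also have "\<dots> \<le> 1 / \<theta> * 1" using assms(1) by (intro mult_left_mono) auto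
      finally show "measure_pmf.prob q {u. \<theta> * pmf q u < pmf (U w) u} \<le> 1 / \<theta>" by simp
    qed
    finally show ?thesis .
  qed
  have "measure_pmf.expectation ?C
      (\<lambda>c. measure_pmf.prob (U (c i)) {u. threshold_decoder U q \<theta> M L c u \<noteq> fst i})
    \<le> measure_pmf.expectation ?C (\<lambda>c. ?A (c i) + (\<Sum>j\<in>I - {i}. ?B (c i) (c j)))"
  proof (rule integral_mono)
    fix c
    have "measure_pmf.prob (U (c i)) {u. threshold_decoder U q \<theta> M L c u \<noteq> fst i}
       \<le> measure_pmf.prob (U (c i)) ({u. pmf (U (c i)) u \<le> \<theta> * pmf q u} \<union>
           (\<Union>j\<in>I - {i}. {u. \<theta> * pmf q u < pmf (U (c j)) u}))"
      using threshold_decoder_error[of "fst i" "snd i" M L U q \<theta> c] i unfolding I_def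
      by (intro measure_pmf.finite_measure_mono) auto
    also have "\<dots> \<le> ?A (c i) + measure_pmf.prob (U (c i)) (\<Union>j\<in>I - {i}. {u. \<theta> * pmf q u < pmf (U (c j)) u})"
      by (rule measure_Un_le) auto
    also have "\<dots> \<le> ?A (c i) + (\<Sum>j\<in>I - {i}. ?B (c i) (c j))"
      by (intro add_left_mono measure_pmf.finite_measure_subadditive_finite) (use finI in auto)
    finally show "measure_pmf.prob (U (c i)) {u. threshold_decoder U q \<theta> M L c u \<noteq> fst i}
      \<le> ?A (c i) + (\<Sum>j\<in>I - {i}. ?B (c i) (c j))" .
  qed (auto intro!: ib Bochner_Integration.integrable_add Bochner_Integration.integrable_sum)
  also have "\<dots> = measure_pmf.expectation ?C (\<lambda>c. ?A (c i))
      + (\<Sum>j\<in>I - {i}. measure_pmf.expectation ?C (\<lambda>c. ?B (c i) (c j)))"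
    by (subst Bochner_Integration.integral_add)
      (auto simp: Bochner_Integration.integral_sum[OF ib] intro!: ib Bochner_Integration.integrable_sum)
  also have "\<dots> \<le> measure_pmf.expectation p ?A + (\<Sum>j\<in>I - {i}. 1 / \<theta>)"
    using expectation_Pi_pmf_component[OF finI iI, of d p ?A] by (intro add_mono sum_mono two) auto
  also have "\<dots> \<le> measure_pmf.expectation p ?A + real M * real L / \<theta>"
  proof -
    have "card (I - {i}) \<le> M * L" using cI finI by (metis card_Diff1_le)
    then have "real (card (I - {i})) \<le> real M * real L" by (metis of_nat_le_iff of_nat_mult)
    then show ?thesis using assms(1) by (simp add: divide_right_mono)
  qed
  finally show ?thesis by (simp add: prob_joint_pmf I_def q_def)
qed

text \<open>One selection from the weighted sum controls error and covering defect by the same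
  codebook. The weight stays free because its useful value depends on the block length.\<close>

lemma random_codebook:
  fixes p :: "'v pmf" and U :: "'v \<Rightarrow> 'u pmf" and V :: "'v \<Rightarrow> 'w pmf"
  assumes "1 \<le> M" and "1 \<le> L" and "0 < \<theta>" and "0 \<le> \<tau>" and "0 \<le> \<kappa>"
  shows "\<exists>c dec. (\<forall>i\<in>{1..M} \<times> {1..L}. c i \<in> set_pmf p) \<and> (\<forall>u. dec u \<in> {1..M}) \<and>
    (\<Sum>i\<in>{1..M} \<times> {1..L}. measure_pmf.prob (U (c i)) {u. dec u \<noteq> fst i}) / (real M * real L)
    + \<kappa> * ((\<Sum>m=1..M. covering_defect p V \<tau> ({m} \<times> {1..L}) c) / M)
    \<le> measure_pmf.prob (joint_pmf p U) {(v, u). pmf (U v) u \<le> \<theta> * pmf (bind_pmf p U) u} + real M * real L / \<theta>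
    + \<kappa> * (measure_pmf.prob (joint_pmf p V) {(v, w). \<tau> * pmf (bind_pmf p V) w < pmf (V v) w} + sqrt (\<tau> / L))"
    (is "\<exists>c dec. _ \<and> _ \<and> _ \<le> ?a + \<kappa> * ?\<beta>")
proof -
  define I where "I = {1..M} \<times> {1..L}"
  define dec where "dec = threshold_decoder U (bind_pmf p U) \<theta> M L"
  define err where "err c = (\<Sum>i\<in>I. measure_pmf.prob (U (c i)) {u. dec c u \<noteq> fst i}) / (real M * real L)" for c
  define D where "D c = (\<Sum>m=1..M. covering_defect p V \<tau> ({m} \<times> {1..L}) c) / M" for c
  let ?C = "Pi_pmf I undefined (\<lambda>_. p)"
  have finI: "finite I" and cI: "real (card I) = real M * real L" by (auto simp: I_def)
  have pos: "real M > 0" "real L > 0" using assms by auto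
  have ib: "integrable (measure_pmf ?C) (\<lambda>c. measure_pmf.prob (U (c i)) {u. dec c u \<noteq> fst i})" for i
    by (rule integrable_measure_pmf_bounded[where B=1]) auto
  have ic: "integrable (measure_pmf ?C) (\<lambda>c. covering_defect p V \<tau> S c)" for S
    by (rule integrable_measure_pmf_bounded[where B=1]) (simp add: covering_defect_bounds(1,2)[OF assms(4)])
  have errb: "\<bar>err c\<bar> \<le> 1" for c
    unfolding err_def cI[symmetric] by (rule average_abs_le) auto
  have Db: "\<bar>D c\<bar> \<le> 1" for c
    unfolding D_def using average_abs_le[of "{1..M}" "\<lambda>m. covering_defect p V \<tau> ({m} \<times> {1..L}) c" 1]
    by (simp add: covering_defect_bounds(1,2)[OF assms(4)])
  have Eerr: "measure_pmf.expectation ?C err \<le> ?a"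
  proof -
    have "measure_pmf.expectation ?C err
      = (\<Sum>i\<in>I. measure_pmf.expectation ?C (\<lambda>c. measure_pmf.prob (U (c i)) {u. dec c u \<noteq> fst i})) / (real M * real L)"
      unfolding err_def[abs_def] by (simp add: Bochner_Integration.integral_sum[OF ib])
    also have "\<dots> \<le> (\<Sum>i\<in>I. ?a) / (real M * real L)"
      unfolding I_def dec_def using assms(3) by (intro divide_right_mono sum_mono expectation_decoding_error) auto
    also have "\<dots> = ?a" using pos cI by simp
    finally show ?thesis .
  qed
  have ED: "measure_pmf.expectation ?C D \<le> ?\<beta>"
  proof -
    have "measure_pmf.expectation ?C D
      = (\<Sum>m=1..M. measure_pmf.expectation ?C (covering_defect p V \<tau> ({m} \<times> {1..L}))) / M"
      unfolding D_def[abs_def] by (simp add: Bochner_Integration.integral_sum[OF ic])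
    also have "\<dots> \<le> (\<Sum>m=1..M. ?\<beta>) / M"
    proof (intro divide_right_mono sum_mono)
      fix m assume m: "m \<in> {1..M}"
      have "card ({m} \<times> {1..L}) = L" and "{m} \<times> {1..L} \<subseteq> I"
        using m by (auto simp: card_cartesian_product I_def)
      then show "measure_pmf.expectation ?C (covering_defect p V \<tau> ({m} \<times> {1..L})) \<le> ?\<beta>"
        using expectation_covering_defect[OF finI _ _ assms(4), of "{m} \<times> {1..L}" undefined p V] assms(2)
        by simp
    qed auto
    also have "\<dots> = ?\<beta>" using pos by simp
    finally show ?thesis .
  qed
  have i1: "integrable (measure_pmf ?C) err" and i2: "integrable (measure_pmf ?C) D"
    by (auto intro!: integrable_measure_pmf_bounded[where B=1] errb Db)
  have "\<bar>err c + \<kappa> * D c\<bar> \<le> 1 + \<kappa>" for c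
  proof -
    have "\<bar>\<kappa> * D c\<bar> \<le> \<kappa> * 1" unfolding abs_mult using Db[of c] assms(5) by (intro mult_mono) auto
    then show ?thesis using errb[of c] by linarith
  qed
  from exists_le_expectation[of "\<lambda>c. err c + \<kappa> * D c", OF this]
  obtain c where c: "c \<in> set_pmf ?C"
    "err c + \<kappa> * D c \<le> measure_pmf.expectation ?C (\<lambda>c. err c + \<kappa> * D c)" by blast
  note c(2)
  also have "measure_pmf.expectation ?C (\<lambda>c. err c + \<kappa> * D c)
      = measure_pmf.expectation ?C err + \<kappa> * measure_pmf.expectation ?C D"
    using i1 i2 by simp
  also have "\<dots> \<le> ?a + \<kappa> * ?\<beta>" using Eerr ED assms(5) by (intro add_mono mult_left_mono) auto
  finally have "err c + \<kappa> * D c \<le> ?a + \<kappa> * ?\<beta>" .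
  moreover have "\<forall>i\<in>I. c i \<in> set_pmf p"
    using c(1) set_Pi_pmf_subset'[OF finI, of undefined "\<lambda>_. p"] by (auto simp: PiE_dflt_def)
  moreover have "\<forall>u. dec c u \<in> {1..M}" unfolding dec_def by (intro allI threshold_decoder_range assms(1))
  ultimately show ?thesis unfolding err_def D_def I_def by (intro exI[of _ c] exI[of _ "dec c"]) simp
qed

section \<open>Variational distance, likelihood ratios and relative entropy\<close>

lemma joint_pmf_marginals [simp]:
  "map_pmf fst (joint_pmf p V) = p" "map_pmf snd (joint_pmf p V) = bind_pmf p V"
  by (simp_all add: joint_pmf_def map_bind_pmf pmf.map_comp o_def bind_return_pmf' map_pmf_const)

lemma variational_distance_ge:
  "\<bar>measure_pmf.prob P A - measure_pmf.prob Q A\<bar> \<le> variational_distance P Q"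
  unfolding variational_distance_def
proof (rule cSUP_upper)
  show "bdd_above (range (\<lambda>A. \<bar>measure_pmf.prob P A - measure_pmf.prob Q A\<bar>))"
  proof (rule bdd_aboveI2)
    fix A show "\<bar>measure_pmf.prob P A - measure_pmf.prob Q A\<bar> \<le> 1"
      using measure_pmf.prob_le_1[of P A] measure_pmf.prob_le_1[of Q A]
        measure_nonneg[of P A] measure_nonneg[of Q A] by linarith
  qed
qed simp

lemma variational_distance_nonneg: "0 \<le> variational_distance P Q"
  using variational_distance_ge[of P UNIV Q] by simp

text \<open>The factor 2 comes from replacing the reference law \<open>q\<close> by the actual second marginal.\<close>
lemma variational_distance_joint_le:
  fixes p :: "'v pmf" and V :: "'v \<Rightarrow> 'u pmf"
  assumes dev: "\<And>v A. v \<in> set_pmf p \<Longrightarrow> \<bar>measure_pmf.prob (V v) A - measure_pmf.prob q A\<bar> \<le> \<delta> v"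
    and \<delta>: "\<And>v. 0 \<le> \<delta> v" "\<And>v. \<delta> v \<le> 1"
  shows "variational_distance (joint_pmf p V) (pair_pmf p (bind_pmf p V)) \<le> 2 * measure_pmf.expectation p \<delta>"
  unfolding variational_distance_def
proof (rule cSUP_least)
  fix B :: "('v \<times> 'u) set"
  define r where "r = bind_pmf p V"
  define s where "s v = {u. (v, u) \<in> B}" for v
  have ib: "integrable (measure_pmf p) (\<lambda>c. measure_pmf.prob (f c) (g c))" for f g
    by (rule integrable_measure_pmf_bounded[where B=1]) auto
  have i\<delta>: "integrable (measure_pmf p) \<delta>"
    by (rule integrable_measure_pmf_bounded[where B=1]) (use \<delta> in auto)
  have rq: "\<bar>measure_pmf.prob r A - measure_pmf.prob q A\<bar> \<le> measure_pmf.expectation p \<delta>" for A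
  proof -
    have "measure_pmf.prob r A - measure_pmf.prob q A
       = measure_pmf.expectation p (\<lambda>v. measure_pmf.prob (V v) A - measure_pmf.prob q A)"
      by (simp add: r_def prob_bind_pmf ib)
    also have "\<bar>\<dots>\<bar> \<le> measure_pmf.expectation p (\<lambda>v. \<bar>measure_pmf.prob (V v) A - measure_pmf.prob q A\<bar>)"
      by (rule integral_abs_bound)
    also have "\<dots> \<le> measure_pmf.expectation p \<delta>"
      by (intro integral_mono_AE i\<delta> integrable_abs Bochner_Integration.integrable_diff ib)
         (auto simp: AE_measure_pmf_iff dev)
    finally show ?thesis .
  qed
  have J: "measure_pmf.prob (joint_pmf p V) B = measure_pmf.expectation p (\<lambda>v. measure_pmf.prob (V v) (s v))"
    by (simp add: prob_joint_pmf s_def)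
  have pr: "pair_pmf p r = joint_pmf p (\<lambda>_. r)" by (simp add: joint_pmf_def pair_pmf_def map_pmf_def)
  have R: "measure_pmf.prob (pair_pmf p r) B = measure_pmf.expectation p (\<lambda>v. measure_pmf.prob r (s v))"
    unfolding pr by (simp add: prob_joint_pmf s_def)
  have "measure_pmf.prob (joint_pmf p V) B - measure_pmf.prob (pair_pmf p r) B
     = measure_pmf.expectation p (\<lambda>v. measure_pmf.prob (V v) (s v) - measure_pmf.prob r (s v))"
    unfolding J R by (simp add: ib)
  also have "\<bar>\<dots>\<bar> \<le> measure_pmf.expectation p (\<lambda>v. \<bar>measure_pmf.prob (V v) (s v) - measure_pmf.prob r (s v)\<bar>)"
    by (rule integral_abs_bound)
  also have "\<dots> \<le> measure_pmf.expectation p (\<lambda>v. \<delta> v + measure_pmf.expectation p \<delta>)"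
  proof (intro integral_mono_AE integrable_abs Bochner_Integration.integrable_diff ib Bochner_Integration.integrable_add i\<delta>)
    show "AE v in measure_pmf p. \<bar>measure_pmf.prob (V v) (s v) - measure_pmf.prob r (s v)\<bar>
      \<le> \<delta> v + measure_pmf.expectation p \<delta>"
      unfolding AE_measure_pmf_iff
    proof
      fix v assume "v \<in> set_pmf p"
      from dev[OF this, of "s v"] rq[of "s v"]
      show "\<bar>measure_pmf.prob (V v) (s v) - measure_pmf.prob r (s v)\<bar> \<le> \<delta> v + measure_pmf.expectation p \<delta>"
        by linarith
    qed
  qed auto
  also have "\<dots> = 2 * measure_pmf.expectation p \<delta>" using i\<delta> by simp
  finally show "\<bar>measure_pmf.prob (joint_pmf p V) B - measure_pmf.prob (pair_pmf p (bind_pmf p V)) B\<bar>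
    \<le> 2 * measure_pmf.expectation p \<delta>" by (simp add: r_def)
qed simp

text \<open>On the event that the log-ratio exceeds \<eta>, \<open>Q\<close> has at most the
  fraction \<open>b powr (-\<eta>)\<close> of the mass of \<open>P\<close>, so the two masses
  already differ by the remaining fraction.\<close>

lemma prob_log_ratio_le_variational_distance:
  assumes "b > 1" and "\<eta> > 0"
  shows "measure_pmf.prob P {w. log b (pmf P w / pmf Q w) > \<eta>} \<le> variational_distance P Q / (1 - b powr (-\<eta>))"
proof -
  let ?A = "{w. log b (pmf P w / pmf Q w) > \<eta>}"
  have lt1: "b powr (-\<eta>) < 1" using assms by (simp add: powr_less_one)
  have "measure_pmf.prob Q ?A \<le> b powr (-\<eta>) * measure_pmf.prob P ?A"
  proof (rule prob_le_scaled)
    fix w assume "w \<in> ?A" "w \<in> set_pmf Q"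
    then have l: "log b (pmf P w / pmf Q w) > \<eta>" and q: "pmf Q w > 0" by (auto simp: pmf_positive)
    \<comment> \<open>Since \<open>ln 0 = 0\<close>, a point of \<open>P\<close>-mass zero has
      log-ratio 0, which is not above \<eta>.\<close>
    then have "pmf P w \<noteq> 0" using assms by (auto simp: log_def)
    then have p: "pmf P w > 0" by (simp add: pmf_pos)
    have "b powr \<eta> < pmf P w / pmf Q w" using l p q assms by (subst (asm) less_log_iff) auto
    then show "pmf Q w \<le> b powr (-\<eta>) * pmf P w"
      using q assms by (simp add: powr_minus field_simps)
  qed simp
  moreover have "measure_pmf.prob P ?A - measure_pmf.prob Q ?A \<le> variational_distance P Q"
    using variational_distance_ge[of P ?A Q] by linarith
  ultimately have "(1 - b powr (-\<eta>)) * measure_pmf.prob P ?A \<le> variational_distance P Q"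
    by (simp add: algebra_simps)
  then show ?thesis using lt1 by (simp add: pos_le_divide_eq mult.commute)
qed

text \<open>Inclusion of the supports makes the ratio a density of \<open>P\<close> with respect to
  \<open>Q\<close>. The equation includes the non-integrable case, where both Bochner integrals take
  the default value 0.\<close>

lemma relative_entropy_eq_expectation:
  assumes "b > 1" and "set_pmf P \<subseteq> set_pmf Q"
  shows "relative_entropy b P Q = measure_pmf.expectation P (\<lambda>w. log b (pmf P w / pmf Q w))"
proof -
  have d: "measure_pmf P = density (measure_pmf Q) (\<lambda>w. ennreal (pmf P w / pmf Q w))"
  proof (rule measure_eqI)
    fix A assume "A \<in> sets (measure_pmf P)"
    have "emeasure (density (measure_pmf Q) (\<lambda>w. ennreal (pmf P w / pmf Q w))) A
      = (\<integral>\<^sup>+w. ennreal (pmf Q w) * (ennreal (pmf P w / pmf Q w) * indicator A w) \<partial>count_space UNIV)"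
      by (simp add: emeasure_density nn_integral_measure_pmf)
    also have "\<dots> = (\<integral>\<^sup>+w. ennreal (pmf P w) * indicator A w \<partial>count_space UNIV)"
    proof (rule nn_integral_cong)
      fix w
      show "ennreal (pmf Q w) * (ennreal (pmf P w / pmf Q w) * indicator A w) = ennreal (pmf P w) * indicator A w"
        using assms(2) by (cases "pmf Q w = 0")
          (auto simp: indicator_def set_pmf_iff simp flip: ennreal_mult)
    qed
    also have "\<dots> = emeasure P A" by (simp flip: nn_integral_measure_pmf)
    finally show "emeasure P A = emeasure (density (measure_pmf Q) (\<lambda>w. ennreal (pmf P w / pmf Q w))) A" by simp
  qed simp
  have "relative_entropy b P Q
    = KL_divergence b (measure_pmf Q) (density (measure_pmf Q) (\<lambda>w. ennreal (pmf P w / pmf Q w)))"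
    unfolding relative_entropy_def using d by simp
  also have "\<dots> = (\<integral>w. (pmf P w / pmf Q w) * log b (pmf P w / pmf Q w) \<partial>Q)"
    using assms(1) by (intro sigma_finite_measure.KL_density prob_space_imp_sigma_finite)
       (auto intro: measure_pmf.prob_space_axioms)
  also have "\<dots> = (\<integral>w. log b (pmf P w / pmf Q w) \<partial>density (measure_pmf Q) (\<lambda>w. ennreal (pmf P w / pmf Q w)))"
    by (subst integral_real_density) auto
  also have "\<dots> = measure_pmf.expectation P (\<lambda>w. log b (pmf P w / pmf Q w))"
    using d by simp
  finally show ?thesis .
qed


subsection \<open>One-shot direct and converse bounds\<close>

lemma pmf_joint_pmf: "pmf (joint_pmf p U) (v, u) = pmf p v * pmf (U v) u"
proof -
  have "pmf (joint_pmf p U) (v, u) = measure_pmf.expectation p (\<lambda>v'. pmf (map_pmf (Pair v') (U v')) (v, u))"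
    by (simp add: joint_pmf_def pmf_bind)
  also have "\<dots> = measure_pmf.expectation p (\<lambda>v'. indicator {v} v' * pmf (U v) u)"
  proof (intro arg_cong[where f="measure_pmf.expectation p"] ext)
    fix v'
    show "pmf (map_pmf (Pair v') (U v')) (v, u) = indicator {v} v' * pmf (U v) u"
    proof (cases "v' = v")
      case True
      then show ?thesis by (simp add: pmf_map_inj' inj_def)
    next
      case False
      then have "(v, u) \<notin> set_pmf (map_pmf (Pair v') (U v'))" by auto
      then have "pmf (map_pmf (Pair v') (U v')) (v, u) = 0"
        by (simp only: pmf_eq_0_set_pmf not_False_eq_True)
      then show ?thesis using False by simp
    qed
  qed
  also have "\<dots> = pmf p v * pmf (U v) u" by (simp add: measure_pmf_single)
  finally show ?thesis .
qed

lemma set_joint_pmf: "(v, u) \<in> set_pmf (joint_pmf p U) \<longleftrightarrow> v \<in> set_pmf p \<and> u \<in> set_pmf (U v)"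
  by (auto simp: joint_pmf_def)

lemma joint_pmf_density:
  assumes "(v, u) \<in> set_pmf (joint_pmf p U)"
  shows "pmf (joint_pmf p U) (v, u) / pmf (map_pmf fst (joint_pmf p U)) v / pmf (map_pmf snd (joint_pmf p U)) u
      = pmf (U v) u / pmf (bind_pmf p U) u"
    and "pmf (joint_pmf p U) (v, u) / pmf (pair_pmf p (bind_pmf p U)) (v, u)
      = pmf (U v) u / pmf (bind_pmf p U) u"
    and "0 < pmf (U v) u" and "0 < pmf (bind_pmf p U) u"
  using assms by (auto simp: pmf_joint_pmf set_joint_pmf pmf_pair pmf_positive_iff set_pmf_iff)

text \<open>The form without quotient and logarithm suits change of measure. The two events agree on
  the support only, where all masses are positive.\<close>

lemma prob_info_density_law_le:
  assumes "b > 1" and "n \<ge> 1"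
  shows "measure_pmf.prob (info_density_law b n (joint_pmf p U)) {..r}
    = measure_pmf.prob (joint_pmf p U) {(v, u). pmf (U v) u \<le> b powr (real n * r) * pmf (bind_pmf p U) u}"
proof -
  have "measure_pmf.prob (info_density_law b n (joint_pmf p U)) {..r}
    = measure_pmf.prob (joint_pmf p U) ((\<lambda>(v, y). 1 / real n *
       log b ((pmf (joint_pmf p U) (v, y) / pmf (map_pmf fst (joint_pmf p U)) v) / pmf (map_pmf snd (joint_pmf p U)) y)) -` {..r})"
    by (simp add: info_density_law_def)
  also have "\<dots> = measure_pmf.prob (joint_pmf p U) {(v, u). pmf (U v) u \<le> b powr (real n * r) * pmf (bind_pmf p U) u}"
    (is "measure_pmf.prob _ ?A = measure_pmf.prob _ ?B")
  proof (rule measure_pmf.finite_measure_eq_AE)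
    have "w \<in> ?A \<longleftrightarrow> w \<in> ?B" if w: "w \<in> set_pmf (joint_pmf p U)" for w
    proof -
      obtain v u where vu: "w = (v, u)" by (cases w)
      note d = joint_pmf_density[OF w[unfolded vu]]
      have "w \<in> ?A \<longleftrightarrow> 1 / real n * log b (pmf (U v) u / pmf (bind_pmf p U) u) \<le> r"
        by (simp only: vu vimage_eq prod.case atMost_iff d(1))
      also have "\<dots> \<longleftrightarrow> log b (pmf (U v) u / pmf (bind_pmf p U) u) \<le> real n * r"
        using assms(2) by (simp add: field_simps)
      also have "\<dots> \<longleftrightarrow> pmf (U v) u / pmf (bind_pmf p U) u \<le> b powr (real n * r)"
        using assms d by (subst log_le_iff) auto
      also have "\<dots> \<longleftrightarrow> w \<in> ?B"
        using d by (simp add: vu pos_divide_le_eq)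
      finally show ?thesis .
    qed
    then show "AE w in joint_pmf p U. w \<in> ?A \<longleftrightarrow> w \<in> ?B" unfolding AE_measure_pmf_iff by blast
  qed auto
  finally show ?thesis .
qed

lemma prob_pmf_greaterThan: "measure_pmf.prob B {r<..} = 1 - measure_pmf.prob B {..r::real}"
  using measure_pmf.prob_compl[of "{..r}" B] by (simp add: Compl_eq_Diff_UNIV flip: Compl_atMost)

lemma prob_info_density_law_gt:
  assumes "b > 1" and "n \<ge> 1"
  shows "measure_pmf.prob (info_density_law b n (joint_pmf p U)) {r<..}
    = measure_pmf.prob (joint_pmf p U) {(v, u). b powr (real n * r) * pmf (bind_pmf p U) u < pmf (U v) u}"
  unfolding prob_pmf_greaterThan prob_info_density_law_le[OF assms]
  by (subst measure_pmf.prob_compl[symmetric]) (auto intro!: arg_cong[where f="measure_pmf.prob _"])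

text \<open>The bridge from the information density to the log-ratio inside \<open>S3\<close> and
  \<open>S6\<close>: dividing by the marginals in turn or by their product is the same
  function.\<close>

lemma prob_info_density_law_gt_log_ratio:
  "measure_pmf.prob (info_density_law b n (joint_pmf p U)) {r<..}
    = measure_pmf.prob (joint_pmf p U)
        {w. 1 / real n * log b (pmf (joint_pmf p U) w / pmf (pair_pmf p (bind_pmf p U)) w) > r}"
proof -
  have "measure_pmf.prob (info_density_law b n (joint_pmf p U)) {r<..}
    = measure_pmf.prob (joint_pmf p U) ((\<lambda>(v, y). 1 / real n *
       log b ((pmf (joint_pmf p U) (v, y) / pmf (map_pmf fst (joint_pmf p U)) v) / pmf (map_pmf snd (joint_pmf p U)) y)) -` {r<..})"
    by (simp add: info_density_law_def)
  also have "\<dots> = measure_pmf.prob (joint_pmf p U)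
        {w. 1 / real n * log b (pmf (joint_pmf p U) w / pmf (pair_pmf p (bind_pmf p U)) w) > r}"
    by (rule arg_cong[where f="measure_pmf.prob _"]) (auto simp: pmf_pair)
  finally show ?thesis .
qed

section \<open>Disintegration of the input law and composition with the channel\<close>

text \<open>The conditional law of X given V. \<open>cond_pmf\<close> is unspecified for
  \<open>v\<close> of probability zero, so pointwise facts are stated on the support of the first
  marginal.\<close>

definition conditional_kernel :: "('v \<times> 'x) pmf \<Rightarrow> 'v \<Rightarrow> 'x pmf" where
  "conditional_kernel P v = map_pmf snd (cond_pmf P {w. v = fst w})"

lemma joint_pmf_conditional_kernel: "joint_pmf (map_pmf fst P) (conditional_kernel P) = P"
proof -
  have ne: "set_pmf P \<inter> {w. v = fst w} \<noteq> {}" if "v \<in> set_pmf (map_pmf fst P)" for v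
    using that by auto
  have "joint_pmf (map_pmf fst P) (conditional_kernel P) = bind_pmf (map_pmf fst P) (\<lambda>v. cond_pmf P {w. v = fst w})"
    unfolding joint_pmf_def
  proof (rule bind_pmf_cong[OF refl])
    fix v assume "v \<in> set_pmf (map_pmf fst P)"
    note ne = ne[OF this]
    have "map_pmf (Pair v) (conditional_kernel P v) = map_pmf (\<lambda>w. (v, snd w)) (cond_pmf P {w. v = fst w})"
      by (simp add: conditional_kernel_def pmf.map_comp o_def)
    also have "\<dots> = map_pmf id (cond_pmf P {w. v = fst w})"
      by (rule map_pmf_cong) (use ne in auto)
    finally show "map_pmf (Pair v) (conditional_kernel P v) = cond_pmf P {w. v = fst w}" by simp
  qed
  also have "\<dots> = P"
  proof (rule bind_cond_pmf_cancel)
    fix v w assume "v \<in> set_pmf (map_pmf fst P)" "w \<in> set_pmf P" "v = fst w"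
    then show "measure_pmf.prob P {w. v = fst w} = measure_pmf.prob (map_pmf fst P) {v. v = fst w}"
      by (auto intro!: arg_cong[where f="measure_pmf.prob _"])
  qed (use ne in auto)
  finally show ?thesis .
qed

lemma set_conditional_kernel:
  assumes "v \<in> set_pmf (map_pmf fst P)" and "x \<in> set_pmf (conditional_kernel P v)"
  shows "(v, x) \<in> set_pmf P"
  using assms joint_pmf_conditional_kernel[of P] by (metis set_joint_pmf)

lemma joint_VY_joint_pmf:
  assumes "P n = joint_pmf p K"
  shows "joint_VY W P n = joint_pmf p (\<lambda>v. map_pmf fst (bind_pmf (K v) (W n)))"
  unfolding joint_VY_def markov_joint_def assms joint_pmf_def
  by (simp add: map_bind_pmf bind_assoc_pmf bind_map_pmf case_prod_unfold map_pmf_def bind_return_pmf)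

lemma joint_VZ_joint_pmf:
  assumes "P n = joint_pmf p K"
  shows "joint_VZ W P n = joint_pmf p (\<lambda>v. map_pmf snd (bind_pmf (K v) (W n)))"
  unfolding joint_VZ_def markov_joint_def assms joint_pmf_def
  by (simp add: map_bind_pmf bind_assoc_pmf bind_map_pmf case_prod_unfold map_pmf_def bind_return_pmf)

text \<open>A code is an input process with V the uniform message and the encoder as kernel from V
  to X; the leakage is then a functional of the law of (V,Z).\<close>

lemma message_output_joint_pmf:
  "message_output W n M enc = joint_pmf (pmf_of_set {1..M}) (\<lambda>m. map_pmf snd (bind_pmf (enc m) (W n)))"
  unfolding message_output_def joint_pmf_def
  by (simp add: bind_assoc_pmf bind_map_pmf case_prod_unfold map_pmf_def bind_return_pmf)

lemma expectation_pmf_of_set_atLeastAtMost: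
  fixes f :: "nat \<Rightarrow> real"
  assumes "1 \<le> M"
  shows "measure_pmf.expectation (pmf_of_set {1..M}) f = (\<Sum>m=1..M. f m) / M"
  using assms by (subst integral_pmf_of_set) auto

text \<open>The average over messages matches the codebook sum of the direct part; the probability
  of a joint event is what the converse bounds.\<close>

lemma error_probability_eq:
  assumes "1 \<le> M"
  shows "error_probability W n M enc dec
    = (\<Sum>m=1..M. measure_pmf.prob (map_pmf fst (bind_pmf (enc m) (W n))) {y. dec y \<noteq> m}) / M"
    and "error_probability W n M enc dec
    = measure_pmf.prob (joint_pmf (pmf_of_set {1..M}) (\<lambda>m. map_pmf fst (bind_pmf (enc m) (W n)))) {(m, y). dec y \<noteq> m}"
  unfolding error_probability_def prob_joint_pmf expectation_pmf_of_set_atLeastAtMost[OF assms] map_bind_pmf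
      prob_bind_pmf by simp_all

text \<open>\<open>random_codebook\<close> is applied to the two output kernels obtained by
  composing the kernel from V to X with the channel. The local choice of \<open>l\<close> is
  absorbed into the encoder, so averages over codewords become error and leakage of a stochastic
  code.\<close>

lemma one_shot_wiretap_code:
  fixes W :: "nat \<Rightarrow> 'x list \<Rightarrow> ('y list \<times> 'z list) pmf" and P :: "nat \<Rightarrow> (nat \<times> 'x list) pmf"
  assumes b: "b > 1" and n: "n \<ge> 1" and len: "\<forall>(v, x)\<in>set_pmf (P n). length x = n"
    and M: "1 \<le> M" and L: "1 \<le> L" and \<kappa>: "0 \<le> \<kappa>"
  shows "\<exists>enc dec. (\<forall>m\<in>{1..M}. \<forall>x\<in>set_pmf (enc m). length x = n) \<and> (\<forall>y. dec y \<in> {1..M}) \<and>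
    error_probability W n M enc dec + \<kappa> * (leakage b W S2 \<eta> n M enc / 2)
    \<le> measure_pmf.prob (info_density_law b n (joint_VY W P n)) {..r} + real M * real L / b powr (real n * r)
      + \<kappa> * (measure_pmf.prob (info_density_law b n (joint_VZ W P n)) {s<..} + sqrt (b powr (real n * s) / L))"
proof -
  define p where "p = map_pmf fst (P n)"
  define K where "K = conditional_kernel (P n)"
  define U where "U v = map_pmf fst (bind_pmf (K v) (W n))" for v
  define V where "V v = map_pmf snd (bind_pmf (K v) (W n))" for v
  have PK: "P n = joint_pmf p K" by (simp add: p_def K_def joint_pmf_conditional_kernel)
  have JY: "joint_VY W P n = joint_pmf p U" and JZ: "joint_VZ W P n = joint_pmf p V"
    by (simp_all add: joint_VY_joint_pmf[where P=P and n=n, OF PK] joint_VZ_joint_pmf[where P=P and n=n, OF PK] U_def[abs_def] V_def[abs_def])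
  have "0 < b powr (real n * r)" "0 \<le> b powr (real n * s)" using b by auto
  from random_codebook[OF M L this \<kappa>, of p U V]
  have "\<exists>c dec. (\<forall>i\<in>{1..M} \<times> {1..L}. c i \<in> set_pmf p) \<and> (\<forall>u. dec u \<in> {1..M}) \<and>
    (\<Sum>i\<in>{1..M} \<times> {1..L}. measure_pmf.prob (U (c i)) {u. dec u \<noteq> fst i}) / (real M * real L)
    + \<kappa> * ((\<Sum>m=1..M. covering_defect p V (b powr (real n * s)) ({m} \<times> {1..L}) c) / M)
    \<le> measure_pmf.prob (info_density_law b n (joint_VY W P n)) {..r} + real M * real L / b powr (real n * r)
      + \<kappa> * (measure_pmf.prob (info_density_law b n (joint_VZ W P n)) {s<..} + sqrt (b powr (real n * s) / L))"
    unfolding JY JZ prob_info_density_law_le[OF b n] prob_info_density_law_gt[OF b n] .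
  then obtain c dec where c: "\<forall>i\<in>{1..M} \<times> {1..L}. c i \<in> set_pmf p" and dec: "\<forall>u. dec u \<in> {1..M}"
    and bound: "(\<Sum>i\<in>{1..M} \<times> {1..L}. measure_pmf.prob (U (c i)) {u. dec u \<noteq> fst i}) / (real M * real L)
    + \<kappa> * ((\<Sum>m=1..M. covering_defect p V (b powr (real n * s)) ({m} \<times> {1..L}) c) / M)
    \<le> measure_pmf.prob (info_density_law b n (joint_VY W P n)) {..r} + real M * real L / b powr (real n * r)
      + \<kappa> * (measure_pmf.prob (info_density_law b n (joint_VZ W P n)) {s<..} + sqrt (b powr (real n * s) / L))"
    by (elim exE conjE) (rule that)
  define enc where "enc m = bind_pmf (pmf_of_set {1..L}) (\<lambda>l. K (c (m, l)))" for m
  have encU: "map_pmf fst (bind_pmf (enc m) (W n)) = bind_pmf (pmf_of_set {1..L}) (\<lambda>l. U (c (m, l)))"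
   and encV: "map_pmf snd (bind_pmf (enc m) (W n)) = bind_pmf (pmf_of_set {1..L}) (\<lambda>l. V (c (m, l)))" for m
    by (simp_all add: enc_def U_def V_def map_bind_pmf bind_assoc_pmf)
  have "length x = n" if "m \<in> {1..M}" "x \<in> set_pmf (enc m)" for m x
  proof -
    from that(2) obtain l where l: "l \<in> {1..L}" "x \<in> set_pmf (K (c (m, l)))"
      using L by (auto simp: enc_def)
    with that(1) c have "(c (m, l), x) \<in> set_pmf (P n)"
      unfolding p_def K_def by (intro set_conditional_kernel) auto
    then show ?thesis using len by auto
  qed
  moreover have "error_probability W n M enc dec
     = (\<Sum>i\<in>{1..M} \<times> {1..L}. measure_pmf.prob (U (c i)) {u. dec u \<noteq> fst i}) / (real M * real L)"
  proof -
    have "error_probability W n M enc dec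
      = (\<Sum>m=1..M. (\<Sum>l=1..L. measure_pmf.prob (U (c (m, l))) {u. dec u \<noteq> m}) / L) / M"
      unfolding error_probability_eq(1)[OF M] encU prob_bind_pmf expectation_pmf_of_set_atLeastAtMost[OF L] ..
    also have "\<dots> = (\<Sum>m=1..M. \<Sum>l=1..L. measure_pmf.prob (U (c (m, l))) {u. dec u \<noteq> m}) / (real M * real L)"
      by (simp add: sum_divide_distrib mult.commute)
    finally show ?thesis by (simp add: sum.cartesian_product case_prod_unfold)
  qed
  \<comment> \<open>The halving undoes the factor 2 lost when the reference output law is replaced
    by the true marginal.\<close>
  moreover have "leakage b W S2 \<eta> n M enc / 2 \<le> (\<Sum>m=1..M. covering_defect p V (b powr (real n * s)) ({m} \<times> {1..L}) c) / M"
  proof -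
    define \<delta> where "\<delta> m = covering_defect p V (b powr (real n * s)) ({m} \<times> {1..L}) c" for m
    have "variational_distance (joint_pmf (pmf_of_set {1..M}) (\<lambda>m. map_pmf snd (bind_pmf (enc m) (W n))))
       (pair_pmf (pmf_of_set {1..M}) (bind_pmf (pmf_of_set {1..M}) (\<lambda>m. map_pmf snd (bind_pmf (enc m) (W n)))))
       \<le> 2 * measure_pmf.expectation (pmf_of_set {1..M}) \<delta>"
    proof (rule variational_distance_joint_le[where q="bind_pmf p V"])
      fix m A assume "m \<in> set_pmf (pmf_of_set {1..M})"
      have "measure_pmf.prob (map_pmf snd (bind_pmf (enc m) (W n))) A
         = (\<Sum>l\<in>{m} \<times> {1..L}. measure_pmf.prob (V (c l)) A) / card ({m} \<times> {1..L})"
        unfolding encV prob_bind_pmf expectation_pmf_of_set_atLeastAtMost[OF L]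
        by (simp add: sum.cartesian_product' card_cartesian_product)
      then show "\<bar>measure_pmf.prob (map_pmf snd (bind_pmf (enc m) (W n))) A - measure_pmf.prob (bind_pmf p V) A\<bar> \<le> \<delta> m"
        unfolding \<delta>_def using L
        by (simp only:) (rule output_deviation_le_covering_defect, auto)
    qed (simp_all add: \<delta>_def covering_defect_bounds)
    then show ?thesis
      unfolding leakage_def message_output_joint_pmf Let_def joint_pmf_marginals
      by (simp only: secrecy_metric.simps expectation_pmf_of_set_atLeastAtMost[OF M] \<delta>_def)
  qed
  from mult_left_mono[OF this \<kappa>] bound calculation(2)
  have "error_probability W n M enc dec + \<kappa> * (leakage b W S2 \<eta> n M enc / 2)
    \<le> measure_pmf.prob (info_density_law b n (joint_VY W P n)) {..r} + real M * real L / b powr (real n * r)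
      + \<kappa> * (measure_pmf.prob (info_density_law b n (joint_VZ W P n)) {s<..} + sqrt (b powr (real n * s) / L))"
    by linarith
  ultimately show ?thesis using dec by blast
qed

section \<open>Comparison of the secrecy metrics for a uniform message\<close>

text \<open>The output law is the average of the \<open>M\<close> conditional laws, hence at least
  \<open>1 / M\<close> times each of them.\<close>

lemma uniform_joint_density_le:
  fixes M :: nat
  assumes "1 \<le> M" and "w \<in> set_pmf (joint_pmf (pmf_of_set {1..M}) V)"
  shows "pmf (joint_pmf (pmf_of_set {1..M}) V) w / pmf (pair_pmf (pmf_of_set {1..M}) (bind_pmf (pmf_of_set {1..M}) V)) w \<le> M"
    and "0 < pmf (joint_pmf (pmf_of_set {1..M}) V) w / pmf (pair_pmf (pmf_of_set {1..M}) (bind_pmf (pmf_of_set {1..M}) V)) w"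
proof -
  obtain m u where w: "w = (m, u)" by (cases w)
  note d = joint_pmf_density[OF assms(2)[unfolded w]]
  have m: "m \<in> {1..M}" using assms set_pmf_of_set[of "{1..M}"] by (simp add: w set_joint_pmf)
  have "pmf (V m) u / M \<le> (\<Sum>m=1..M. pmf (V m) u) / M"
    using member_le_sum[OF m, of "\<lambda>m. pmf (V m) u"] by (intro divide_right_mono) auto
  also have "\<dots> = pmf (bind_pmf (pmf_of_set {1..M}) V) u"
    unfolding pmf_bind using assms(1) by (subst expectation_pmf_of_set_atLeastAtMost) auto
  finally show "pmf (joint_pmf (pmf_of_set {1..M}) V) w / pmf (pair_pmf (pmf_of_set {1..M}) (bind_pmf (pmf_of_set {1..M}) V)) w \<le> M"
    using d(4) assms(1) unfolding w d(2) by (simp add: field_simps)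
  show "0 < pmf (joint_pmf (pmf_of_set {1..M}) V) w / pmf (pair_pmf (pmf_of_set {1..M}) (bind_pmf (pmf_of_set {1..M}) V)) w"
    using d(3,4) unfolding w d(2) by simp
qed

lemma set_joint_pmf_subset_pair:
  "set_pmf (joint_pmf p V) \<subseteq> set_pmf (pair_pmf p (bind_pmf p V))"
  by (auto simp: set_joint_pmf)

text \<open>For \<open>S4\<close> the log-ratio never exceeds \<open>log b M\<close> and exceeds 1
  only with probability of order \<open>v\<close>, so the relative entropy is at most 1 plus
  \<open>log b M\<close> times that probability; the normalization \<open>1 / n\<close> removes the
  1. One sum of nonnegative terms serves all four metrics.\<close>

lemma leakage_le_variational:
  fixes W :: "nat \<Rightarrow> 'x list \<Rightarrow> ('y list \<times> 'z list) pmf" and enc :: "nat \<Rightarrow> 'x list pmf"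
  assumes b: "b > 1" and n: "n \<ge> 1" and \<eta>: "\<eta> > 0" and M: "1 \<le> M" and i: "i \<in> {S2, S3, S4, S6}"
  defines "v \<equiv> leakage b W S2 \<eta> n M enc"
  shows "leakage b W i \<eta> n M enc
    \<le> v + v / (1 - b powr (-\<eta>)) + 1 / real n + 1 / real n * log b M * (v / (1 - b powr (-1)))"
proof -
  define V where "V m = map_pmf snd (bind_pmf (enc m) (W n))" for m
  define P where "P = joint_pmf (pmf_of_set {1..M}) V"
  define Q where "Q = pair_pmf (pmf_of_set {1..M}) (bind_pmf (pmf_of_set {1..M}) V)"
  have leak: "leakage b W j \<eta> n M enc = secrecy_metric b j \<eta> n P Q" for j
    by (simp add: leakage_def Let_def message_output_joint_pmf P_def Q_def V_def[abs_def])
  have v: "v = variational_distance P Q" by (simp add: v_def leak)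
  have v0: "0 \<le> v" by (simp add: v variational_distance_nonneg)
  have pw: "b powr (-x) < 1" if "x > 0" for x using that b by (simp add: powr_less_one)
  have lM: "0 \<le> log b M" using b M by simp
  have nn: "0 \<le> v / (1 - b powr (-\<eta>))" "0 \<le> 1 / real n" "0 \<le> 1 / real n * log b M * (v / (1 - b powr (-1)))"
    using v0 pw[OF \<eta>] pw[of 1] lM by (auto intro!: mult_nonneg_nonneg divide_nonneg_nonneg)
  have s3: "measure_pmf.prob P {w. log b (pmf P w / pmf Q w) > x} \<le> v / (1 - b powr (-x))" if "x > 0" for x
    unfolding v by (rule prob_log_ratio_le_variational_distance[OF b that])
  consider "i = S2" | "i = S3" | "i = S4" | "i = S6" using i by blast
  then show ?thesis
  proof cases
    case 1
    then show ?thesis using nn by (simp add: leak v)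
  next
    case 2
    show ?thesis unfolding 2 leak secrecy_metric.simps using nn v0 s3[OF \<eta>] by linarith
  next
    case 3
    define X where "X w = log b (pmf P w / pmf Q w)" for w
    have "relative_entropy b P Q = measure_pmf.expectation P X"
      unfolding X_def P_def Q_def
      by (rule relative_entropy_eq_expectation[OF b set_joint_pmf_subset_pair])
    also have "\<dots> \<le> 1 + log b M * measure_pmf.prob P {w. X w > 1}"
    proof (cases "integrable (measure_pmf P) X")
      case True
      have "measure_pmf.expectation P X \<le> measure_pmf.expectation P (\<lambda>w. 1 + log b M * indicator {w. X w > 1} w)"
      proof (rule integral_mono_AE[OF True])
        show "integrable (measure_pmf P) (\<lambda>w. 1 + log b M * indicator {w. X w > 1} w)"
          by (rule integrable_measure_pmf_bounded[where B="1 + log b M"]) (use lM in \<open>auto simp: indicator_def\<close>)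
        show "AE w in measure_pmf P. X w \<le> 1 + log b M * indicator {w. X w > 1} w"
          unfolding AE_measure_pmf_iff
        proof
          fix w assume "w \<in> set_pmf P"
          with uniform_joint_density_le[OF M, of w V] have "X w \<le> log b M"
            using b M by (auto simp: P_def Q_def X_def)
          then show "X w \<le> 1 + log b M * indicator {w. X w > 1} w" by (auto simp: indicator_def)
        qed
      qed
      also have "\<dots> = 1 + log b M * measure_pmf.prob P {w. X w > 1}"
        by (subst Bochner_Integration.integral_add) (auto intro!: integrable_mult_right integrable_measure_pmf_bounded[where B=1])
      finally show ?thesis .
    next
      \<comment> \<open>The expectation then has the default value 0, below the nonnegative
        bound.\<close>
      case False
      then show ?thesis using lM by (simp add: not_integrable_integral_eq)
    qed
    also have "\<dots> \<le> 1 + log b M * (v / (1 - b powr (-1)))"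
      using s3[of 1] lM unfolding X_def by (intro add_left_mono mult_left_mono) auto
    finally have "1 / real n * relative_entropy b P Q \<le> 1 / real n * (1 + log b M * (v / (1 - b powr (-1))))"
      by (intro mult_left_mono) auto
    then show ?thesis using 3 nn(1) v0 by (simp add: leak algebra_simps)
  next
    case 4
    have "measure_pmf.prob P {w. 1 / real n * log b (pmf P w / pmf Q w) > \<eta>}
       \<le> measure_pmf.prob P {w. log b (pmf P w / pmf Q w) > \<eta>}"
    proof (intro measure_pmf.finite_measure_mono subsetI)
      fix w assume "w \<in> {w. 1 / real n * log b (pmf P w / pmf Q w) > \<eta>}"
      then have "real n * \<eta> < log b (pmf P w / pmf Q w)" using n by (simp add: field_simps)
      moreover have "1 * \<eta> \<le> real n * \<eta>" using n \<eta> by (intro mult_right_mono) auto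
      ultimately show "w \<in> {w. log b (pmf P w / pmf Q w) > \<eta>}" by simp
    qed simp
    then show ?thesis unfolding 4 leak secrecy_metric.simps using nn v0 s3[OF \<eta>] by linarith
  qed
qed

text \<open>Decoding correctly restricts \<open>(m, u)\<close> to a set of product probability at most \<open>1 / M\<close>.\<close>
lemma prob_small_density_le_error:
  fixes V :: "nat \<Rightarrow> 'u pmf"
  assumes "1 \<le> M" and "0 \<le> \<theta>"
  defines "J \<equiv> joint_pmf (pmf_of_set {1..M}) V" and "q \<equiv> bind_pmf (pmf_of_set {1..M}) V"
  shows "measure_pmf.prob J {(m, u). pmf (V m) u \<le> \<theta> * pmf q u}
    \<le> measure_pmf.prob J {(m, u). dec u \<noteq> m} + \<theta> / M"
proof -
  let ?A = "{(m, u). pmf (V m) u \<le> \<theta> * pmf q u}" and ?E = "{(m, u). dec u \<noteq> m}"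
  define p where "p = pmf_of_set {1..M}"
  have "measure_pmf.prob J (?A - ?E) \<le> \<theta> * measure_pmf.prob (pair_pmf q p) {(u, m). dec u = m}"
  proof -
    have "measure_pmf.prob J (?A - ?E) \<le> \<theta> * measure_pmf.prob (pair_pmf p q) (?A - ?E)"
    proof (rule prob_le_scaled)
      fix w assume "w \<in> ?A - ?E"
      then obtain m u where w: "w = (m, u)" "pmf (V m) u \<le> \<theta> * pmf q u" by auto
      have "pmf p m * pmf (V m) u \<le> pmf p m * (\<theta> * pmf q u)" using w(2) by (rule mult_left_mono) simp
      then show "pmf J w \<le> \<theta> * pmf (pair_pmf p q) w"
        unfolding w(1) J_def pmf_joint_pmf pmf_pair p_def[symmetric] by (simp only: mult_ac)
    qed (rule assms(2))
    also have "\<dots> \<le> \<theta> * measure_pmf.prob (pair_pmf p q) {(m, u). dec u = m}"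
      using assms(2) by (intro mult_left_mono measure_pmf.finite_measure_mono) auto
    also have "measure_pmf.prob (pair_pmf p q) {(m, u). dec u = m} = measure_pmf.prob (pair_pmf q p) {(u, m). dec u = m}"
      by (subst pair_commute_pmf) (auto intro!: arg_cong[where f="measure_pmf.prob _"])
    finally show ?thesis .
  qed
  also have "measure_pmf.prob (pair_pmf q p) {(u, m). dec u = m} \<le> 1 / M"
  proof -
    have "pair_pmf q p = joint_pmf q (\<lambda>_. p)" by (simp add: joint_pmf_def pair_pmf_def map_pmf_def)
    then have "measure_pmf.prob (pair_pmf q p) {(u, m). dec u = m}
       = measure_pmf.expectation q (\<lambda>u. measure_pmf.prob p {dec u})"
      by (simp add: prob_joint_pmf)
    also have "\<dots> \<le> 1 / M"
    proof (intro measure_pmf.integral_le_const integrable_measure_pmf_bounded[where B=1] AE_pmfI)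
      fix u
      show "measure_pmf.prob p {dec u} \<le> 1 / M"
        using assms(1) by (simp add: p_def measure_pmf_single pmf_of_set indicator_def)
    qed auto
    finally show ?thesis .
  qed
  finally have 1: "measure_pmf.prob J (?A - ?E) \<le> \<theta> / M" using assms(2) by (simp add: mult_left_mono)
  have "measure_pmf.prob J ?A \<le> measure_pmf.prob J (?E \<union> (?A - ?E))"
    by (rule measure_pmf.finite_measure_mono) auto
  also have "\<dots> \<le> measure_pmf.prob J ?E + measure_pmf.prob J (?A - ?E)" by (rule measure_Un_le) auto
  finally show ?thesis using 1 by simp
qed

text \<open>
  The negative part of the log-likelihood ratio has expectation at most \<open>1 / ln b\<close> under \<open>P\<close>;
  the upper bound \<open>K\<close> is what makes the ratio integrable.
\<close>
lemma prob_log_ratio_le_relative_entropy: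
  assumes b: "b > 1" and sub: "set_pmf P \<subseteq> set_pmf Q"
    and K: "\<And>w. w \<in> set_pmf P \<Longrightarrow> pmf P w / pmf Q w \<le> K" and g: "0 < g"
  shows "measure_pmf.prob P {w. log b (pmf P w / pmf Q w) > g} \<le> (relative_entropy b P Q + 1 / ln b) / g"
proof -
  define X where "X w = log b (pmf P w / pmf Q w)" for w
  define Y where "Y w = pmf Q w / pmf P w" for w
  have pos: "0 < pmf P w" "0 < pmf Q w" if "w \<in> set_pmf P" for w
    using that sub by (auto simp: pmf_positive)
  have lnb: "0 < ln b" using b by simp
  have "(\<integral>\<^sup>+w. ennreal (Y w) \<partial>P) = (\<integral>\<^sup>+w. ennreal (pmf P w) * ennreal (Y w) \<partial>count_space UNIV)"
    by (rule nn_integral_measure_pmf)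
  also have "\<dots> \<le> (\<integral>\<^sup>+w. ennreal (pmf Q w) \<partial>count_space UNIV)"
    by (intro nn_integral_mono) (auto simp: Y_def simp flip: ennreal_mult)
  also have "\<dots> = 1" by (simp add: nn_integral_pmf)
  finally have nY: "(\<integral>\<^sup>+w. ennreal (Y w) \<partial>P) \<le> 1" .
  have Y0: "0 \<le> Y w" for w by (simp add: Y_def)
  have iY: "integrable (measure_pmf P) Y"
    using nY Y0 by (intro integrableI_bounded) (auto simp: less_top[symmetric] top_unique)
  have EY: "measure_pmf.expectation P Y \<le> 1"
    using nY nn_integral_eq_integral[OF iY] Y0 by simp
  \<comment> \<open>The inequality \<open>ln y \<le> y - 1\<close> for the inverse ratio
    \<open>Y\<close>, whose \<open>P\<close>-mean is at most 1; this is where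
    \<open>1 / ln b\<close> comes from.\<close>
  have low: "- X w \<le> Y w / ln b" if "w \<in> set_pmf P" for w
  proof -
    have "ln (Y w) \<le> Y w - 1" using pos[OF that] by (intro ln_le_minus_one) (simp add: Y_def)
    moreover have "- X w = ln (Y w) / ln b"
      using pos[OF that] by (simp add: X_def Y_def log_def ln_div diff_divide_distrib)
    ultimately show ?thesis using lnb by (simp add: divide_right_mono)
  qed
  have up: "X w \<le> \<bar>log b K\<bar>" if "w \<in> set_pmf P" for w
  proof -
    have "X w \<le> log b K" unfolding X_def using b pos[OF that] K[OF that]
      by (subst log_le_cancel_iff) (auto intro: less_le_trans[of 0 "pmf P w / pmf Q w"])
    then show ?thesis by simp
  qed
  have iX: "integrable (measure_pmf P) X"
  proof (rule Bochner_Integration.integrable_bound)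
    show "integrable (measure_pmf P) (\<lambda>w. \<bar>log b K\<bar> + Y w / ln b)" using iY by simp
    show "AE w in measure_pmf P. norm (X w) \<le> norm (\<bar>log b K\<bar> + Y w / ln b)"
      unfolding AE_measure_pmf_iff
    proof
      fix w assume w: "w \<in> set_pmf P"
      have "0 \<le> Y w / ln b" using Y0[of w] lnb by simp
      with low[OF w] up[OF w] show "norm (X w) \<le> norm (\<bar>log b K\<bar> + Y w / ln b)" by (simp add: abs_le_iff)
    qed
  qed simp
  \<comment> \<open>Markov's inequality, applied to \<open>X + Y / ln b\<close> because this sum is
    nonnegative on the support while \<open>X\<close> need not be.\<close>
  have "g * measure_pmf.prob P {w. X w > g} = measure_pmf.expectation P (\<lambda>w. g * indicator {w. X w > g} w)"
    by simp
  also have "\<dots> \<le> measure_pmf.expectation P (\<lambda>w. X w + Y w / ln b)"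
  proof (rule integral_mono_AE)
    show "integrable (measure_pmf P) (\<lambda>w. g * indicator {w. X w > g} w)"
      by (rule integrable_measure_pmf_bounded[where B=g]) (use g in \<open>auto simp: indicator_def\<close>)
    show "integrable (measure_pmf P) (\<lambda>w. X w + Y w / ln b)" using iX iY by simp
    show "AE w in measure_pmf P. g * indicator {w. X w > g} w \<le> X w + Y w / ln b"
      unfolding AE_measure_pmf_iff
    proof
      fix w assume w: "w \<in> set_pmf P"
      have "0 \<le> Y w / ln b" using Y0[of w] lnb by simp
      with low[OF w] show "g * indicator {w. X w > g} w \<le> X w + Y w / ln b" by (auto simp: indicator_def)
    qed
  qed
  also have "\<dots> = measure_pmf.expectation P X + measure_pmf.expectation P Y / ln b" using iX iY by simp
  also have "\<dots> \<le> relative_entropy b P Q + 1 / ln b"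
    using EY lnb relative_entropy_eq_expectation[OF b sub] by (simp add: X_def[abs_def] divide_right_mono)
  finally show ?thesis using g unfolding X_def by (simp add: pos_le_divide_eq mult.commute)
qed


subsection \<open>Sequences of codes\<close>

lemma powr_neg_tendsto_zero:
  fixes b :: real
  assumes "b > 1" and "\<gamma> > 0"
  shows "(\<lambda>n. b powr (- (real n * \<gamma>))) \<longlonglongrightarrow> 0"
proof -
  have "b powr (-\<gamma>) < 1" using assms by (simp add: powr_less_one)
  then have "(\<lambda>n. (b powr (-\<gamma>)) ^ n) \<longlonglongrightarrow> 0"
    by (intro LIMSEQ_power_zero) simp
  moreover have "(b powr (-\<gamma>)) ^ n = b powr (- (real n * \<gamma>))" for n
    using assms by (simp add: powr_power mult.commute)
  ultimately show ?thesis by simp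
qed

lemma nat_ceiling_powr_bounds:
  fixes b :: real
  assumes "b > 1" and "0 \<le> x"
  shows "1 \<le> nat \<lceil>b powr x\<rceil>" "b powr x \<le> real (nat \<lceil>b powr x\<rceil>)" "real (nat \<lceil>b powr x\<rceil>) \<le> 2 * b powr x"
proof -
  have 1: "1 \<le> b powr x" using assms by (simp add: ge_one_powr_ge_zero)
  then show 2: "b powr x \<le> real (nat \<lceil>b powr x\<rceil>)" by linarith
  show "1 \<le> nat \<lceil>b powr x\<rceil>" using 1 by linarith
  show "real (nat \<lceil>b powr x\<rceil>) \<le> 2 * b powr x" using 1 by linarith
qed

section \<open>Direct part for sequences of codes\<close>

text \<open>The error is compared with the distribution function itself plus a vanishing sequence,
  not with a limit, so that it serves limsup and liminf constraints alike.\<close>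

lemma wiretap_codes_exist:
  fixes W :: "nat \<Rightarrow> 'x list \<Rightarrow> ('y list \<times> 'z list) pmf"
  assumes b: "b > 1" and P: "P \<in> input_processes" and \<eta>: "\<eta> > 0" and i: "i \<in> {S2, S3, S4, S6}"
    and R: "0 < R" and s: "0 \<le> s" and r: "R + s < r"
    and vanish: "(\<lambda>n. measure_pmf.prob (info_density_law b n (joint_VZ W P n)) {s<..}) \<longlonglongrightarrow> 0"
  shows "\<exists>M e d enc dec \<delta>. (\<forall>n\<ge>1. wiretap_code b W i \<eta> n (M n) (e n) (d n) (enc n) (dec n)) \<and>
     d \<longlonglongrightarrow> 0 \<and> ereal R \<le> liminf (\<lambda>n. ereal (1 / real n * log b (real (M n)))) \<and> \<delta> \<longlonglongrightarrow> 0 \<and>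
     (\<forall>n. e n \<le> measure_pmf.prob (info_density_law b n (joint_VY W P n)) {..r} + \<delta> n)"
proof -
  \<comment> \<open>Half of the slack: \<open>L\<close> has rate \<open>s + \<gamma>\<close>, so
    \<open>M L\<close> has rate \<open>r - \<gamma>\<close>, and covering and decoding both gain the
    exponent \<gamma>.\<close>
  define \<gamma> where "\<gamma> = (r - R - s) / 2"
  have \<gamma>: "0 < \<gamma>" "R + (s + \<gamma>) - r = - \<gamma>" using r by (auto simp: \<gamma>_def field_simps)
  define M where "M n = nat \<lceil>b powr (real n * R)\<rceil>" for n
  define L where "L n = nat \<lceil>b powr (real n * (s + \<gamma>))\<rceil>" for n
  define A where "A n = measure_pmf.prob (info_density_law b n (joint_VY W P n)) {..r}" for n
  define \<beta> where "\<beta> n = measure_pmf.prob (info_density_law b n (joint_VZ W P n)) {s<..} + sqrt (b powr (- (real n * \<gamma>)))" for n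
  define \<delta> where "\<delta> n = 4 * b powr (- (real n * \<gamma>)) + sqrt (\<beta> n)" for n
  \<comment> \<open>Obtained by solving \<open>\<kappa> * (v / 2) \<le> 1 + \<delta> n\<close> for
    the variational leakage \<open>v\<close>, with the weight
    \<open>\<kappa> = 1 / sqrt (\<beta> n)\<close>.\<close>
  define u where "u n = 2 * sqrt (\<beta> n) * (1 + \<delta> n)" for n
  define d where "d n = u n + u n / (1 - b powr (-\<eta>)) + 1 / real n + (R + log b 2) * (u n / (1 - b powr (-1)))" for n
  have M: "1 \<le> M n" "b powr (real n * R) \<le> M n" "M n \<le> 2 * b powr (real n * R)" for n
    unfolding M_def using nat_ceiling_powr_bounds[OF b, of "real n * R"] R by auto
  have L: "1 \<le> L n" "b powr (real n * (s + \<gamma>)) \<le> L n" "L n \<le> 2 * b powr (real n * (s + \<gamma>))" for n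
    unfolding L_def using nat_ceiling_powr_bounds[OF b, of "real n * (s + \<gamma>)"] s \<gamma>(1) by auto
  have pw: "(\<lambda>n. b powr (- (real n * \<gamma>))) \<longlonglongrightarrow> 0" by (rule powr_neg_tendsto_zero[OF b \<gamma>(1)])
  have \<beta>pos: "0 < \<beta> n" for n
    unfolding \<beta>_def using b by (intro add_nonneg_pos) auto
  have \<beta>0: "\<beta> \<longlonglongrightarrow> 0"
    unfolding \<beta>_def using tendsto_add[OF vanish tendsto_real_sqrt[OF pw]] by simp
  have \<delta>0: "\<delta> \<longlonglongrightarrow> 0"
    unfolding \<delta>_def using tendsto_add[OF tendsto_mult_left[OF pw, of 4] tendsto_real_sqrt[OF \<beta>0]] by simp
  have \<delta>pos: "0 \<le> \<delta> n" for n unfolding \<delta>_def using \<beta>pos[of n] by simp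
  have u0: "u \<longlonglongrightarrow> 0"
    unfolding u_def using tendsto_mult[OF tendsto_mult_left[OF tendsto_real_sqrt[OF \<beta>0], of 2] tendsto_add[OF tendsto_const[of 1] \<delta>0]] by simp
  have d0: "d \<longlonglongrightarrow> 0"
  proof -
    have "d \<longlonglongrightarrow> 0 + 0 / (1 - b powr (-\<eta>)) + 0 + (R + log b 2) * (0 / (1 - b powr (-1)))"
      unfolding d_def using powr_less_one[OF b, of "-\<eta>"] powr_less_one[OF b, of "-1"] \<eta>
      by (intro tendsto_intros u0 lim_1_over_n) linarith+
    then show ?thesis by simp
  qed
  have prodML: "real (M n) * real (L n) / b powr (real n * r) \<le> 4 * b powr (- (real n * \<gamma>))" for n
  proof -
    have "real (M n) * real (L n) \<le> (2 * b powr (real n * R)) * (2 * b powr (real n * (s + \<gamma>)))"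
      using M(3)[of n] L(3)[of n] by (intro mult_mono) auto
    then have "real (M n) * real (L n) / b powr (real n * r)
       \<le> (2 * b powr (real n * R)) * (2 * b powr (real n * (s + \<gamma>))) / b powr (real n * r)"
      by (intro divide_right_mono) auto
    also have "\<dots> = 4 * b powr (real n * R + real n * (s + \<gamma>) - real n * r)"
      by (simp add: powr_add powr_diff)
    also have "real n * R + real n * (s + \<gamma>) - real n * r = real n * (R + (s + \<gamma>) - r)" by (simp add: algebra_simps)
    also have "\<dots> = - (real n * \<gamma>)" by (simp only: \<gamma>(2) mult_minus_right)
    finally show ?thesis .
  qed
  have sL: "sqrt (b powr (real n * s) / real (L n)) \<le> sqrt (b powr (- (real n * \<gamma>)))" for n
  proof -
    have "b powr (real n * s) / real (L n) \<le> b powr (real n * s) / b powr (real n * (s + \<gamma>))"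
      using L(2)[of n] b by (intro divide_left_mono) (auto intro!: mult_pos_pos less_le_trans[OF _ L(2)])
    also have "\<dots> = b powr (real n * s - real n * (s + \<gamma>))" by (simp add: powr_diff)
    also have "real n * s - real n * (s + \<gamma>) = - (real n * \<gamma>)" by (simp add: algebra_simps)
    finally show ?thesis by simp
  qed
  have logM: "1 / real n * log b (M n) \<le> R + log b 2" if n: "n \<ge> 1" for n
  proof -
    have "log b (M n) \<le> log b (2 * b powr (real n * R))"
      using M[of n] b by (subst log_le_cancel_iff) auto
    also have "\<dots> = log b 2 + real n * R" using b by (simp add: log_mult)
    finally have "1 / real n * log b (M n) \<le> 1 / real n * (log b 2 + real n * R)" by (intro mult_left_mono) auto
    also have "\<dots> = R + log b 2 / real n" using n by (simp add: field_simps)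
    also have "log b 2 / real n \<le> log b 2 / 1" using n b by (intro divide_left_mono) auto
    finally show ?thesis by simp
  qed
  have "\<exists>enc dec. wiretap_code b W i \<eta> n (M n) (A n + \<delta> n) (d n) enc dec" if n: "n \<ge> 1" for n
  proof -
    \<comment> \<open>This weight turns the leakage contribution to the error bound into
      \<open>sqrt (\<beta> n)\<close>, which vanishes, while \<open>1 / \<kappa>\<close> vanishes as
      well. The exponential term in \<open>\<beta> n\<close> keeps it positive even if the tail
      probability is zero.\<close>
    define \<kappa> where "\<kappa> = 1 / sqrt (\<beta> n)"
    have \<kappa>: "0 < \<kappa>" using \<beta>pos[of n] by (simp add: \<kappa>_def)
    have len: "\<forall>(v, x)\<in>set_pmf (P n). length x = n" using P n by (auto simp: input_processes_def)
    from one_shot_wiretap_code[where P=P and n=n and W=W and \<eta>=\<eta> and r=r and s=s, OF b n len M(1)[of n] L(1)[of n] less_imp_le[OF \<kappa>]]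
    obtain enc dec where enc: "\<forall>m\<in>{1..M n}. \<forall>x\<in>set_pmf (enc m). length x = n" and dec: "\<forall>y. dec y \<in> {1..M n}"
      and bound: "error_probability W n (M n) enc dec + \<kappa> * (leakage b W S2 \<eta> n (M n) enc / 2)
        \<le> A n + real (M n) * real (L n) / b powr (real n * r)
          + \<kappa> * (measure_pmf.prob (info_density_law b n (joint_VZ W P n)) {s<..} + sqrt (b powr (real n * s) / L n))"
      by (elim exE conjE) (rule that, assumption, assumption, unfold A_def, assumption)
    define v where "v = leakage b W S2 \<eta> n (M n) enc"
    have v0: "0 \<le> v" by (simp add: v_def leakage_def Let_def variational_distance_nonneg)
    have e0: "0 \<le> error_probability W n (M n) enc dec"
      unfolding error_probability_eq(2)[OF M(1)] by simp
    have "\<kappa> * (measure_pmf.prob (info_density_law b n (joint_VZ W P n)) {s<..} + sqrt (b powr (real n * s) / L n)) \<le> \<kappa> * \<beta> n"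
      using sL[of n] \<kappa> unfolding \<beta>_def by (intro mult_left_mono) auto
    also have "\<kappa> * \<beta> n = sqrt (\<beta> n)" using \<beta>pos[of n] by (simp add: \<kappa>_def real_div_sqrt)
    finally have total: "error_probability W n (M n) enc dec + \<kappa> * (v / 2) \<le> A n + \<delta> n"
      using bound prodML[of n] unfolding \<delta>_def v_def by linarith
    have err: "error_probability W n (M n) enc dec \<le> A n + \<delta> n"
      using total mult_nonneg_nonneg[OF less_imp_le[OF \<kappa>], of "v / 2"] v0 by linarith
    \<comment> \<open>The error is dropped as nonnegative and \<open>A n\<close> is at most 1, so no
      smallness of the error is involved.\<close>
    have "\<kappa> * (v / 2) \<le> 1 + \<delta> n" using total e0 measure_pmf.prob_le_1[of "info_density_law b n (joint_VY W P n)" "{..r}"]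
      unfolding A_def by linarith
    then have "v \<le> u n" using \<beta>pos[of n] by (simp add: \<kappa>_def u_def field_simps)
    have pl: "b powr (-x) < 1" if "x > 0" for x using that b by (simp add: powr_less_one)
    have "leakage b W i \<eta> n (M n) enc
      \<le> v + v / (1 - b powr (-\<eta>)) + 1 / real n + 1 / real n * log b (M n) * (v / (1 - b powr (-1)))"
      unfolding v_def by (rule leakage_le_variational[OF b n \<eta> M(1) i])
    also have "\<dots> \<le> u n + u n / (1 - b powr (-\<eta>)) + 1 / real n + (R + log b 2) * (u n / (1 - b powr (-1)))"
      using \<open>v \<le> u n\<close> v0 pl[OF \<eta>] pl[of 1] logM[OF n] R b
      by (intro add_mono mult_mono divide_right_mono order_refl divide_nonneg_nonneg add_nonneg_nonneg) auto
    finally have "leakage b W i \<eta> n (M n) enc \<le> d n" by (simp add: d_def)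
    with M(1)[of n] enc dec err show ?thesis unfolding wiretap_code_def by blast
  qed
  then obtain enc dec where code: "\<And>n. n \<ge> 1 \<Longrightarrow> wiretap_code b W i \<eta> n (M n) (A n + \<delta> n) (d n) (enc n) (dec n)"
    by metis
  have "ereal R \<le> liminf (\<lambda>n. ereal (1 / real n * log b (real (M n))))"
  proof (rule Liminf_bounded, rule eventually_sequentiallyI[of 1])
    fix n :: nat assume n: "1 \<le> n"
    have "real n * R \<le> log b (M n)" using M(2)[of n] b M(1)[of n] by (subst le_log_iff) auto
    then show "ereal R \<le> ereal (1 / real n * log b (real (M n)))" using n by (simp add: field_simps)
  qed
  then show ?thesis
    using code d0 \<delta>0 by (intro exI[of _ M] exI[of _ "\<lambda>n. A n + \<delta> n"] exI[of _ d] exI[of _ enc] exI[of _ dec] exI[of _ \<delta>])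
      (auto simp: A_def)
qed

text \<open>A single message is decoded without error and leaks nothing. This settles every rate up
  to 0, where the random code, built for positive rate, does not apply.\<close>

lemma trivial_wiretap_codes_exist:
  fixes W :: "nat \<Rightarrow> 'x list \<Rightarrow> ('y list \<times> 'z list) pmf"
  assumes b: "b > 1" and \<eta>: "\<eta> > 0" and i: "i \<in> {S2, S3, S4, S6}" and R: "R \<le> 0"
  shows "\<exists>M d enc dec. (\<forall>n\<ge>1. wiretap_code b W i \<eta> n (M n) 0 (d n) (enc n) (dec n)) \<and>
     d \<longlonglongrightarrow> 0 \<and> ereal R \<le> liminf (\<lambda>n. ereal (1 / real n * log b (real (M n))))"
proof -
  define enc where "enc n m = (return_pmf (replicate n undefined) :: 'x list pmf)" for n m :: nat
  define dec where "dec n y = (1::nat)" for n :: nat and y :: "'y list"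
  \<comment> \<open>The \<open>1 / n\<close> is what the common leakage comparison leaves at zero
    variational distance.\<close>
  have "wiretap_code b W i \<eta> n 1 0 (1 / real n) (enc n) (dec n)" if n: "n \<ge> 1" for n
  proof -
    have "leakage b W S2 \<eta> n 1 (enc n) = 0"
    proof -
      have u: "pmf_of_set {1..1::nat} = return_pmf 1" by (simp add: pmf_of_set_singleton)
      have j: "joint_pmf (return_pmf 1) V = pair_pmf (return_pmf 1) (bind_pmf (return_pmf 1) V)" for V :: "nat \<Rightarrow> 'z list pmf"
        by (simp add: joint_pmf_def bind_return_pmf pair_return_pmf1)
      show ?thesis
        unfolding leakage_def message_output_joint_pmf Let_def joint_pmf_marginals u
        unfolding j secrecy_metric.simps variational_distance_def by simp
    qed
    then have "leakage b W i \<eta> n 1 (enc n) \<le> 1 / real n"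
      using leakage_le_variational[OF b n \<eta> order_refl i, of W "enc n"] by simp
    then show ?thesis
      by (auto simp: wiretap_code_def enc_def dec_def error_probability_def)
  qed
  moreover have "(\<lambda>n. 1 / real n) \<longlonglongrightarrow> 0" by (rule lim_1_over_n)
  moreover have "ereal R \<le> liminf (\<lambda>n. ereal (1 / real n * log b (real 1)))"
    using R by (intro Liminf_bounded) auto
  ultimately show ?thesis
    by (intro exI[of _ "\<lambda>_. 1"] exI[of _ "\<lambda>n. 1 / real n"] exI[of _ enc] exI[of _ dec]) auto
qed

section \<open>The limit superior in probability\<close>

lemma eps_p_limsup_1_leI:
  assumes "\<And>x. t < x \<Longrightarrow> (\<lambda>n. measure_pmf.prob (B n) {x<..}) \<longlonglongrightarrow> 0"
  shows "eps_p_limsup 1 B \<le> ereal t"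
  unfolding eps_p_limsup_def
proof (rule Sup_least)
  fix y assume "y \<in> ereal ` {r. liminf (\<lambda>n. ereal (measure_pmf.prob (B n) {..r})) < ereal 1}"
  then obtain r where y: "y = ereal r" and r: "liminf (\<lambda>n. ereal (measure_pmf.prob (B n) {..r})) < ereal 1"
    by auto
  have "r \<le> t"
  proof (rule ccontr)
    assume "\<not> r \<le> t"
    then have "(\<lambda>n. 1 - measure_pmf.prob (B n) {r<..}) \<longlonglongrightarrow> 1 - 0"
      by (intro tendsto_diff tendsto_const assms) simp
    then have "(\<lambda>n. ereal (measure_pmf.prob (B n) {..r})) \<longlonglongrightarrow> ereal 1"
      by (simp add: prob_pmf_greaterThan)
    from lim_imp_Liminf[OF _ this] r show False by simp
  qed
  then show "y \<le> ereal t" by (simp add: y)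
qed

text \<open>If the tail beyond \<open>s\<close> did not vanish, \<open>s\<close> would belong to the
  set whose supremum is taken. At the value of the supremum itself the tail need not vanish, hence
  the strict inequality.\<close>

lemma eps_p_limsup_1_lessD:
  assumes "eps_p_limsup 1 B < ereal s"
  shows "(\<lambda>n. measure_pmf.prob (B n) {s<..}) \<longlonglongrightarrow> 0"
proof -
  have lim: "1 \<le> liminf (\<lambda>n. ereal (measure_pmf.prob (B n) {..s}))"
  proof (rule ccontr)
    assume "\<not> ?thesis"
    then have "ereal s \<le> eps_p_limsup 1 B"
      unfolding eps_p_limsup_def by (intro Sup_upper) (auto simp: not_le one_ereal_def)
    then show False using assms by simp
  qed
  show ?thesis
  proof (rule order_tendstoI)
    fix a :: real assume "0 < a"
    then have "ereal (1 - a) < liminf (\<lambda>n. ereal (measure_pmf.prob (B n) {..s}))"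
      by (intro less_le_trans[OF _ lim]) simp
    from less_LiminfD[OF this]
    show "\<forall>\<^sub>F n in sequentially. measure_pmf.prob (B n) {s<..} < a"
      by (rule eventually_mono) (simp add: prob_pmf_greaterThan)
  next
    fix a :: real assume "a < 0"
    then show "\<forall>\<^sub>F n in sequentially. a < measure_pmf.prob (B n) {s<..}"
      by (intro always_eventually allI) (auto intro: less_le_trans)
  qed
qed

text \<open>Change of measure bounds the probability of an information density at most
  \<open>x\<close> by \<open>b powr (n * x)\<close>, exponentially small for negative
  \<open>x\<close>. The direct part uses the sign to rule out the value -\<infinity> and to choose a
  codebook rate \<open>s\<close> that is nonnegative.\<close>

lemma info_upper_1_nonneg:
  fixes J :: "nat \<Rightarrow> ('v \<times> 'u) pmf"
  assumes b: "b > 1"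
  shows "0 \<le> info_upper b 1 J"
proof (rule ccontr)
  assume "\<not> ?thesis"
  then obtain x where x: "info_upper b 1 J < ereal x" "ereal x < 0"
    by (meson ereal_dense2 not_le)
  define p where "p n = map_pmf fst (J n)" for n
  define U where "U n = conditional_kernel (J n)" for n
  have J: "J n = joint_pmf (p n) (U n)" for n by (simp add: p_def U_def joint_pmf_conditional_kernel)
  have small: "measure_pmf.prob (info_density_law b n (J n)) {..x} \<le> b powr (- (real n * (-x)))" if n: "n \<ge> 1" for n
  proof -
    have "measure_pmf.prob (info_density_law b n (J n)) {..x} = measure_pmf.expectation (p n)
      (\<lambda>v. measure_pmf.prob (U n v) {u. pmf (U n v) u \<le> b powr (real n * x) * pmf (bind_pmf (p n) (U n)) u})"
      unfolding J prob_info_density_law_le[OF b n] by (simp add: prob_joint_pmf)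
    also have "\<dots> \<le> b powr (real n * x)"
    proof (intro measure_pmf.integral_le_const integrable_measure_pmf_bounded[where B=1] AE_pmfI)
      fix v
      let ?A = "{u. pmf (U n v) u \<le> b powr (real n * x) * pmf (bind_pmf (p n) (U n)) u}"
      have "measure_pmf.prob (U n v) ?A \<le> b powr (real n * x) * measure_pmf.prob (bind_pmf (p n) (U n)) ?A"
        by (rule prob_le_scaled) auto
      also have "\<dots> \<le> b powr (real n * x) * 1" by (intro mult_left_mono) auto
      finally show "measure_pmf.prob (U n v) ?A \<le> b powr (real n * x)" by simp
    qed auto
    finally show ?thesis by simp
  qed
  have "(\<lambda>n. measure_pmf.prob (info_density_law b n (J n)) {x<..}) \<longlonglongrightarrow> 0"
    using x(1) unfolding info_upper_def by (rule eps_p_limsup_1_lessD)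
  moreover have "(\<lambda>n. measure_pmf.prob (info_density_law b n (J n)) {..x}) \<longlonglongrightarrow> 0"
  proof (rule tendsto_sandwich[OF _ _ tendsto_const powr_neg_tendsto_zero[OF b, of "-x"]])
    show "\<forall>\<^sub>F n in sequentially. measure_pmf.prob (info_density_law b n (J n)) {..x} \<le> b powr (- (real n * - x))"
      using small by (intro eventually_sequentiallyI[of 1]) simp
  qed (use x(2) in auto)
  ultimately have "(\<lambda>n. measure_pmf.prob (info_density_law b n (J n)) {x<..}
      + measure_pmf.prob (info_density_law b n (J n)) {..x}) \<longlonglongrightarrow> 0 + 0"
    by (rule tendsto_add)
  then have "(\<lambda>n::nat. 1::real) \<longlonglongrightarrow> 0" by (simp add: prob_pmf_greaterThan)
  then show False by (simp add: LIMSEQ_const_iff)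
qed

section \<open>Converse for sequences of codes\<close>

text \<open>The event is that the unnormalized log-ratio exceeds \<open>n * x\<close>. For
  \<open>S3\<close> this threshold eventually passes any fixed \<eta>, and for \<open>S4\<close> the
  correction \<open>1 / ln b\<close> is divided by \<open>n\<close>; only \<open>S6\<close>,
  normalized like the information density, requires \<open>x\<close> above \<eta>.\<close>

lemma leakage_vanishing_imp_info_density:
  fixes W :: "nat \<Rightarrow> 'x list \<Rightarrow> ('y list \<times> 'z list) pmf" and enc :: "nat \<Rightarrow> nat \<Rightarrow> 'x list pmf"
  assumes b: "b > 1" and \<eta>: "\<eta> > 0" and i: "i \<in> {S2, S3, S4, S6}"
    and M: "\<And>n. n \<ge> 1 \<Longrightarrow> 1 \<le> M n"
    and leak: "\<And>n. n \<ge> 1 \<Longrightarrow> leakage b W i \<eta> n (M n) (enc n) \<le> d n" and d: "d \<longlonglongrightarrow> 0"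
    and x: "(if i = S6 then \<eta> else 0) < x"
  shows "(\<lambda>n. measure_pmf.prob (info_density_law b n (message_output W n (M n) (enc n))) {x<..}) \<longlonglongrightarrow> 0"
proof -
  define V where "V n m = map_pmf snd (bind_pmf (enc n m) (W n))" for n m
  define P where "P n = joint_pmf (pmf_of_set {1..M n}) (V n)" for n
  define Q where "Q n = pair_pmf (pmf_of_set {1..M n}) (bind_pmf (pmf_of_set {1..M n}) (V n))" for n
  define p where "p n = measure_pmf.prob (info_density_law b n (message_output W n (M n) (enc n))) {x<..}" for n
  have leak': "secrecy_metric b i \<eta> n (P n) (Q n) \<le> d n" if "n \<ge> 1" for n
    using leak[OF that] by (simp add: leakage_def Let_def message_output_joint_pmf P_def Q_def V_def[abs_def])
  have p: "p n = measure_pmf.prob (P n) {w. 1 / real n * log b (pmf (P n) w / pmf (Q n) w) > x}" for n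
    unfolding p_def message_output_joint_pmf prob_info_density_law_gt_log_ratio
    by (simp add: P_def Q_def V_def[abs_def])
  have p': "p n = measure_pmf.prob (P n) {w. log b (pmf (P n) w / pmf (Q n) w) > real n * x}" if "n \<ge> 1" for n
    unfolding p using that by (intro arg_cong[where f="measure_pmf.prob _"]) (auto simp: field_simps)
  have p_mono: "p n \<le> measure_pmf.prob (P n) {w. log b (pmf (P n) w / pmf (Q n) w) > y}" if "n \<ge> 1" "y \<le> real n * x" for n y
    unfolding p'[OF that(1)] using that by (intro measure_pmf.finite_measure_mono) auto
  have x0: "0 < x" using x \<eta> by (auto split: if_splits)
  have sandwich: "p \<longlonglongrightarrow> 0" if "\<forall>\<^sub>F n in sequentially. p n \<le> f n" "f \<longlonglongrightarrow> 0" for f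
    by (rule tendsto_sandwich[OF _ that(1) tendsto_const that(2)]) (simp add: p_def)
  consider "i = S2" | "i = S3" | "i = S4" | "i = S6" using i by blast
  then have "p \<longlonglongrightarrow> 0"
  proof cases
    case 1
    have c: "b powr (-x) < 1" using b x0 by (simp add: powr_less_one)
    have "p n \<le> d n / (1 - b powr (-x))" if n: "n \<ge> 1" for n
    proof -
      have "1 * x \<le> real n * x" using n x0 by (intro mult_right_mono) auto
      then have "p n \<le> variational_distance (P n) (Q n) / (1 - b powr (-x))"
        using p_mono[OF n, of x] prob_log_ratio_le_variational_distance[OF b x0, of "P n" "Q n"] by simp
      also have "\<dots> \<le> d n / (1 - b powr (-x))" using leak'[OF n] 1 c by (intro divide_right_mono) auto
      finally show ?thesis .
    qed
    moreover have "(\<lambda>n. d n / (1 - b powr (-x))) \<longlonglongrightarrow> 0" using tendsto_divide[OF d tendsto_const[of "1 - b powr (-x)"]] c by simp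
    ultimately show ?thesis by (intro sandwich eventually_sequentiallyI[of 1])
  next
    case 2
    obtain N where N: "\<eta> \<le> real N * x" using reals_Archimedean3[OF x0] by (meson less_imp_le)
    have "p n \<le> d n" if "n \<ge> max 1 N" for n
    proof -
      have "real N * x \<le> real n * x" using that x0 by (intro mult_right_mono) auto
      then show ?thesis using p_mono[of n \<eta>] leak'[of n] that N 2 by auto
    qed
    then show ?thesis using d by (intro sandwich eventually_sequentiallyI[of "max 1 N"])
  next
    case 3
    have lnb: "0 < ln b" using b by simp
    have "p n \<le> (d n + (1 / real n) * (1 / ln b)) / x" if n: "n \<ge> 1" for n
    proof -
      have "p n \<le> (relative_entropy b (P n) (Q n) + 1 / ln b) / (real n * x)"
        unfolding p'[OF n]
      proof (rule prob_log_ratio_le_relative_entropy[OF b, where K="M n"])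
        show "set_pmf (P n) \<subseteq> set_pmf (Q n)" unfolding P_def Q_def by (rule set_joint_pmf_subset_pair)
        show "pmf (P n) w / pmf (Q n) w \<le> real (M n)" if "w \<in> set_pmf (P n)" for w
          using that uniform_joint_density_le(1)[OF M[OF n], of w "V n"] unfolding P_def Q_def by blast
        show "0 < real n * x" using n x0 by simp
      qed
      also have "\<dots> = (1 / real n * relative_entropy b (P n) (Q n) + (1 / real n) * (1 / ln b)) / x"
        using n x0 by (simp add: field_simps)
      also have "\<dots> \<le> (d n + (1 / real n) * (1 / ln b)) / x"
        using leak'[OF n] 3 x0 by (intro divide_right_mono add_right_mono) auto
      finally show ?thesis .
    qed
    moreover have "(\<lambda>n. (d n + (1 / real n) * (1 / ln b)) / x) \<longlonglongrightarrow> (0 + 0 * (1 / ln b)) / x"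
      using x0 by (intro tendsto_intros d lim_1_over_n) auto
    ultimately show ?thesis by (intro sandwich[of "\<lambda>n. (d n + (1 / real n) * (1 / ln b)) / x"] eventually_sequentiallyI[of 1]) simp_all
  next
    case 4
    have "p n \<le> d n" if n: "n \<ge> 1" for n
    proof -
      have "p n \<le> measure_pmf.prob (P n) {w. 1 / real n * log b (pmf (P n) w / pmf (Q n) w) > \<eta>}"
        unfolding p using x 4 by (intro measure_pmf.finite_measure_mono) auto
      then show ?thesis using leak'[OF n] 4 by simp
    qed
    then show ?thesis using d by (intro sandwich eventually_sequentiallyI[of 1])
  qed
  then show ?thesis by (simp add: p_def[abs_def])
qed

lemma wiretap_codes_converse:
  fixes W :: "nat \<Rightarrow> 'x list \<Rightarrow> ('y list \<times> 'z list) pmf"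
  assumes b: "b > 1" and \<eta>: "\<eta> > 0" and i: "i \<in> {S2, S3, S4, S6}"
    and code: "\<And>n. n \<ge> 1 \<Longrightarrow> wiretap_code b W i \<eta> n (M n) (e n) (d n) (enc n) (dec n)"
    and d: "d \<longlonglongrightarrow> 0" and R: "ereal R \<le> liminf (\<lambda>n. ereal (1 / real n * log b (real (M n))))"
  shows "\<exists>P\<in>input_processes. info_upper b 1 (joint_VZ W P) \<le> ereal (if i = S6 then \<eta> else 0) \<and>
    (\<forall>\<gamma>>0. \<exists>\<delta>. \<delta> \<longlonglongrightarrow> 0 \<and>
      (\<forall>\<^sub>F n in sequentially. measure_pmf.prob (info_density_law b n (joint_VY W P n)) {..R - \<gamma>} \<le> e n + \<delta> n))"
proof -
  define P where "P n = joint_pmf (pmf_of_set {1..M n}) (enc n)" for n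
  have M: "1 \<le> M n" and enc: "\<forall>m\<in>{1..M n}. \<forall>x\<in>set_pmf (enc n m). length x = n"
    and err: "error_probability W n (M n) (enc n) (dec n) \<le> e n"
    and leak: "leakage b W i \<eta> n (M n) (enc n) \<le> d n" if "n \<ge> 1" for n
    using code[OF that] by (auto simp: wiretap_code_def)
  have "P \<in> input_processes"
    unfolding input_processes_def
  proof (safe)
    fix n v x assume n: "1 \<le> n" and "(v, x) \<in> set_pmf (P n)"
    then have "v \<in> {1..M n}" "x \<in> set_pmf (enc n v)"
      using M[OF n] set_pmf_of_set[of "{1..M n}"] by (auto simp: P_def set_joint_pmf)
    then show "length x = n" using enc[OF n] by auto
  qed
  moreover have "info_upper b 1 (joint_VZ W P) \<le> ereal (if i = S6 then \<eta> else 0)"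
    unfolding info_upper_def
  proof (rule eps_p_limsup_1_leI)
    fix x assume x: "(if i = S6 then \<eta> else 0) < x"
    have "joint_VZ W P n = message_output W n (M n) (enc n)" for n
      unfolding message_output_joint_pmf by (rule joint_VZ_joint_pmf) (simp add: P_def)
    then show "(\<lambda>n. measure_pmf.prob (info_density_law b n (joint_VZ W P n)) {x<..}) \<longlonglongrightarrow> 0"
      using leakage_vanishing_imp_info_density[OF b \<eta> i M leak d x] by simp
  qed
  moreover have "\<exists>\<delta>. \<delta> \<longlonglongrightarrow> 0 \<and>
      (\<forall>\<^sub>F n in sequentially. measure_pmf.prob (info_density_law b n (joint_VY W P n)) {..R - \<gamma>} \<le> e n + \<delta> n)"
    if \<gamma>: "\<gamma> > 0" for \<gamma>
  proof (intro exI conjI)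
    show "(\<lambda>n. b powr (- (real n * (\<gamma> / 2)))) \<longlonglongrightarrow> 0" by (rule powr_neg_tendsto_zero[OF b]) (use \<gamma> in simp)
    \<comment> \<open>Half of \<gamma> covers the fluctuation of the rate around its limit inferior;
      the other half makes \<open>b powr (n * (R - \<gamma>)) / M n\<close> exponentially
      small.\<close>
    have "ereal (R - \<gamma> / 2) < liminf (\<lambda>n. ereal (1 / real n * log b (real (M n))))"
      using \<gamma> by (intro less_le_trans[OF _ R]) simp
    from less_LiminfD[OF this] eventually_ge_at_top[of 1]
    show "\<forall>\<^sub>F n in sequentially. measure_pmf.prob (info_density_law b n (joint_VY W P n)) {..R - \<gamma>}
        \<le> e n + b powr (- (real n * (\<gamma> / 2)))"
    proof eventually_elim
      case (elim n)
      then have n: "n \<ge> 1" by simp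
      define U where "U m = map_pmf fst (bind_pmf (enc n m) (W n))" for m
      have J: "joint_VY W P n = joint_pmf (pmf_of_set {1..M n}) U"
        unfolding U_def[abs_def] by (rule joint_VY_joint_pmf) (simp add: P_def)
      have "real n * (R - \<gamma> / 2) \<le> log b (M n)" using elim n by (simp add: field_simps)
      then have ge: "b powr (real n * (R - \<gamma> / 2)) \<le> M n" using M[OF n] b by (subst (asm) le_log_iff) auto
      have "measure_pmf.prob (info_density_law b n (joint_VY W P n)) {..R - \<gamma>}
         \<le> measure_pmf.prob (joint_pmf (pmf_of_set {1..M n}) U) {(m, y). dec n y \<noteq> m} + b powr (real n * (R - \<gamma>)) / M n"
        unfolding J prob_info_density_law_le[OF b n] by (rule prob_small_density_le_error[OF M[OF n]]) simp
      also have "measure_pmf.prob (joint_pmf (pmf_of_set {1..M n}) U) {(m, y). dec n y \<noteq> m} \<le> e n"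
        using err[OF n] unfolding error_probability_eq(2)[OF M[OF n]] U_def[abs_def] .
      also have "b powr (real n * (R - \<gamma>)) / M n \<le> b powr (real n * (R - \<gamma>)) / b powr (real n * (R - \<gamma> / 2))"
        using b M[OF n] by (intro divide_left_mono[OF ge]) auto
      also have "\<dots> = b powr (real n * (R - \<gamma>) - real n * (R - \<gamma> / 2))" by (simp add: powr_diff)
      also have "real n * (R - \<gamma>) - real n * (R - \<gamma> / 2) = - (real n * (\<gamma> / 2))" by (simp add: algebra_simps)
      finally show ?case by simp
    qed
  qed
  ultimately show ?thesis by blast
qed


subsection \<open>The capacity formula\<close>

text \<open>
  Both capacities are instances of one formula, in which \<open>\<Phi>\<close> is the constraint on the error sequence:
  \<open>limsup e \<le> \<epsilon>\<close> for the ordinary capacity, \<open>liminf e < \<epsilon>\<close> for the optimistic one.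
\<close>
definition capacity_under ::
  "((nat \<Rightarrow> real) \<Rightarrow> bool) \<Rightarrow> real \<Rightarrow> (nat \<Rightarrow> 'x list \<Rightarrow> ('y list \<times> 'z list) pmf) \<Rightarrow> leakage_metric \<Rightarrow> real \<Rightarrow> ereal" where
  "capacity_under \<Phi> b W i \<eta> = Sup (ereal ` {R. \<exists>M e d enc dec.
     (\<forall>n\<ge>1. wiretap_code b W i \<eta> n (M n) (e n) (d n) (enc n) (dec n)) \<and> \<Phi> e \<and> d \<longlonglongrightarrow> 0 \<and>
     ereal R \<le> liminf (\<lambda>n. ereal (1 / real n * log b (real (M n))))})"

text \<open>The constraint imposed on error sequences is imposed here on distribution functions at
  \<open>r\<close>; the inner supremum then is \<open>info_lower\<close> for the limsup constraint
  and \<open>info_upper\<close> for the liminf constraint.\<close>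

definition rate_under ::
  "((nat \<Rightarrow> real) \<Rightarrow> bool) \<Rightarrow> real \<Rightarrow> (nat \<Rightarrow> 'x list \<Rightarrow> ('y list \<times> 'z list) pmf) \<Rightarrow> ereal" where
  "rate_under \<Phi> b W = (SUP P\<in>input_processes. rate_difference
     (Sup (ereal ` {r. \<Phi> (\<lambda>n. measure_pmf.prob (info_density_law b n (joint_VY W P n)) {..r})}))
     (info_upper b 1 (joint_VZ W P)))"

text \<open>The distribution function at \<open>R - \<gamma>\<close> lies below the error up to a
  vanishing term, so \<open>\<Phi>\<close> passes to it and \<open>R - \<gamma>\<close> enters the
  inner supremum; \<gamma> then tends to 0.\<close>

lemma capacity_under_le:
  fixes W :: "nat \<Rightarrow> 'x list \<Rightarrow> ('y list \<times> 'z list) pmf"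
  assumes b: "b > 1" and \<eta>: "\<eta> > 0" and i: "i \<in> {S2, S3, S4, S6}"
    and \<Phi>: "\<And>f e \<delta>. \<Phi> e \<Longrightarrow> \<delta> \<longlonglongrightarrow> 0 \<Longrightarrow> \<forall>\<^sub>F n in sequentially. f n \<le> e n + \<delta> n \<Longrightarrow> \<Phi> f"
  shows "capacity_under \<Phi> b W i \<eta> \<le> rate_under \<Phi> b W + ereal (if i = S6 then \<eta> else 0)"
proof -
  define t where "t = (if i = S6 then \<eta> else 0)"
  have "ereal R \<le> rate_under \<Phi> b W + ereal t"
    if code: "\<forall>n\<ge>1. wiretap_code b W i \<eta> n (M n) (e n) (d n) (enc n) (dec n)" and e: "\<Phi> e" and d: "d \<longlonglongrightarrow> 0"
      and R: "ereal R \<le> liminf (\<lambda>n. ereal (1 / real n * log b (real (M n))))" for R M e d enc dec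
  proof -
    from wiretap_codes_converse[OF b \<eta> i _ d R, of W e enc dec] code
    obtain P where P: "P \<in> input_processes" and Z: "info_upper b 1 (joint_VZ W P) \<le> ereal t"
      and Y: "\<And>\<gamma>. \<gamma> > 0 \<Longrightarrow> \<exists>\<delta>. \<delta> \<longlonglongrightarrow> 0 \<and>
        (\<forall>\<^sub>F n in sequentially. measure_pmf.prob (info_density_law b n (joint_VY W P n)) {..R - \<gamma>} \<le> e n + \<delta> n)"
      unfolding t_def by blast
    define s where "s = Sup (ereal ` {r. \<Phi> (\<lambda>n. measure_pmf.prob (info_density_law b n (joint_VY W P n)) {..r})})"
    have "ereal R \<le> s"
    proof (rule ereal_le_epsilon2)
      fix \<gamma> :: real assume "0 < \<gamma>"
      from Y[OF this] e have "\<Phi> (\<lambda>n. measure_pmf.prob (info_density_law b n (joint_VY W P n)) {..R - \<gamma>})"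
        by (blast intro: \<Phi>)
      then have "ereal (R - \<gamma>) \<le> s" unfolding s_def by (intro Sup_upper) auto
      then have "ereal (R - \<gamma>) + ereal \<gamma> \<le> s + ereal \<gamma>" by (rule add_right_mono)
      then show "ereal R \<le> s + ereal \<gamma>" by simp
    qed
    \<comment> \<open>The real bound on the information rate to Z excludes \<infinity>, so
      \<open>rate_difference\<close> is an ordinary subtraction here.\<close>
    then have "ereal R - ereal t \<le> s - info_upper b 1 (joint_VZ W P)" using Z by (rule ereal_minus_mono)
    also have "\<dots> = rate_difference s (info_upper b 1 (joint_VZ W P))"
      using Z by (auto simp: rate_difference_def)
    also have "\<dots> \<le> rate_under \<Phi> b W"
      unfolding rate_under_def s_def using P by (rule SUP_upper)
    finally have "ereal R - ereal t + ereal t \<le> rate_under \<Phi> b W + ereal t" by (rule add_right_mono)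
    then show ?thesis by simp
  qed
  then show ?thesis unfolding capacity_under_def t_def[symmetric] by (auto intro!: Sup_least)
qed

text \<open>Any real rate strictly between the two sides is achieved, by the trivial code if it is
  at most 0 and by random coding otherwise.\<close>

lemma capacity_under_ge:
  fixes W :: "nat \<Rightarrow> 'x list \<Rightarrow> ('y list \<times> 'z list) pmf"
  assumes b: "b > 1" and \<eta>: "\<eta> > 0" and i: "i \<in> {S2, S3, S4, S6}"
    and \<Phi>: "\<And>f e \<delta>. \<Phi> e \<Longrightarrow> \<delta> \<longlonglongrightarrow> 0 \<Longrightarrow> \<forall>\<^sub>F n in sequentially. f n \<le> e n + \<delta> n \<Longrightarrow> \<Phi> f"
    and \<Phi>0: "\<Phi> (\<lambda>_. 0)"
  shows "rate_under \<Phi> b W \<le> capacity_under \<Phi> b W i \<eta>"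
proof (rule ccontr)
  assume "\<not> ?thesis"
  then obtain R where R: "capacity_under \<Phi> b W i \<eta> < ereal R" "ereal R < rate_under \<Phi> b W"
    by (meson ereal_dense2 not_le)
  have "\<exists>M e d enc dec.
     (\<forall>n\<ge>1. wiretap_code b W i \<eta> n (M n) (e n) (d n) (enc n) (dec n)) \<and> \<Phi> e \<and> d \<longlonglongrightarrow> 0 \<and>
     ereal R \<le> liminf (\<lambda>n. ereal (1 / real n * log b (real (M n))))"
  proof (cases "R \<le> 0")
    case True
    from trivial_wiretap_codes_exist[OF b \<eta> i True, of W]
    obtain M d enc dec where "\<forall>n\<ge>1. wiretap_code b W i \<eta> n (M n) 0 (d n) (enc n) (dec n)" "d \<longlonglongrightarrow> 0"
      "ereal R \<le> liminf (\<lambda>n. ereal (1 / real n * log b (real (M n))))" by blast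
    then show ?thesis using \<Phi>0 by (intro exI[of _ M] exI[of _ "\<lambda>_. 0"] exI[of _ d] exI[of _ enc] exI[of _ dec]) simp
  next
    case False
    from R(2) obtain P where P: "P \<in> input_processes" and less: "ereal R < rate_difference
       (Sup (ereal ` {r. \<Phi> (\<lambda>n. measure_pmf.prob (info_density_law b n (joint_VY W P n)) {..r})}))
       (info_upper b 1 (joint_VZ W P))" (is "_ < rate_difference ?s ?t")
      unfolding rate_under_def less_SUP_iff by blast
    have "?t \<noteq> \<infinity>" using less by (auto simp: rate_difference_def)
    then obtain t where t: "?t = ereal t" "0 \<le> t"
      using info_upper_1_nonneg[OF b, of "joint_VZ W P"] by (cases ?t) auto
    have "ereal (R + t) < ?s" using less t by (cases ?s) (auto simp: rate_difference_def)
    then obtain r where r: "R + t < r" "\<Phi> (\<lambda>n. measure_pmf.prob (info_density_law b n (joint_VY W P n)) {..r})"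
      unfolding less_Sup_iff by auto
    \<comment> \<open>Midpoint of \<open>t\<close> and \<open>r - R\<close>: strict room above the
      spectral rate to Z for covering, and below \<open>r\<close> for decoding.\<close>
    define s where "s = (t + (r - R)) / 2"
    have s: "t < s" "R + s < r" using r(1) by (auto simp: s_def field_simps)
    have "(\<lambda>n. measure_pmf.prob (info_density_law b n (joint_VZ W P n)) {s<..}) \<longlonglongrightarrow> 0"
      by (rule eps_p_limsup_1_lessD) (use t(1) s(1) in \<open>simp add: info_upper_def\<close>)
    from wiretap_codes_exist[OF b P \<eta> i _ _ s(2) this] False t(2) s(1)
    obtain M e d enc dec \<delta> where code: "\<forall>n\<ge>1. wiretap_code b W i \<eta> n (M n) (e n) (d n) (enc n) (dec n)"
      "d \<longlonglongrightarrow> 0" "ereal R \<le> liminf (\<lambda>n. ereal (1 / real n * log b (real (M n))))"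
      and e: "\<delta> \<longlonglongrightarrow> 0" "\<forall>n. e n \<le> measure_pmf.prob (info_density_law b n (joint_VY W P n)) {..r} + \<delta> n"
      by (auto simp: not_le)
    have "\<Phi> e" by (rule \<Phi>[OF r(2) e(1)]) (use e(2) in auto)
    with code show ?thesis by blast
  qed
  then have "ereal R \<le> capacity_under \<Phi> b W i \<eta>" unfolding capacity_under_def by (intro Sup_upper) auto
  then show False using R(1) by simp
qed

text \<open>For \<open>S6\<close> the two directions place the capacity at each \<eta> between the
  formula and the formula plus \<eta>; the infimum over \<eta> removes the gap.\<close>

lemma capacity_under_eq_rate_under:
  fixes W :: "nat \<Rightarrow> 'x list \<Rightarrow> ('y list \<times> 'z list) pmf"
  assumes b: "b > 1"
    and \<Phi>: "\<And>f e \<delta>. \<Phi> e \<Longrightarrow> \<delta> \<longlonglongrightarrow> 0 \<Longrightarrow> \<forall>\<^sub>F n in sequentially. f n \<le> e n + \<delta> n \<Longrightarrow> \<Phi> f"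
    and \<Phi>0: "\<Phi> (\<lambda>_. 0)"
  shows "(\<forall>i\<in>{S2, S3, S4}. \<forall>\<eta>>0. capacity_under \<Phi> b W i \<eta> = rate_under \<Phi> b W) \<and>
    (INF \<eta>\<in>{0<..}. capacity_under \<Phi> b W S6 \<eta>) = rate_under \<Phi> b W"
proof (intro conjI ballI allI impI antisym)
  fix i \<eta> assume "i \<in> {S2, S3, S4}" and \<eta>: "(0::real) < \<eta>"
  then have i: "i \<in> {S2, S3, S4, S6}" "i \<noteq> S6" by auto
  show "capacity_under \<Phi> b W i \<eta> \<le> rate_under \<Phi> b W"
    using capacity_under_le[where \<Phi>=\<Phi> and W=W, OF b \<eta> i(1) \<Phi>] i(2) by (simp add: zero_ereal_def[symmetric])
  show "rate_under \<Phi> b W \<le> capacity_under \<Phi> b W i \<eta>"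
    by (rule capacity_under_ge[where \<Phi>=\<Phi> and W=W, OF b \<eta> i(1) \<Phi> \<Phi>0])
next
  show "(INF \<eta>\<in>{0<..}. capacity_under \<Phi> b W S6 \<eta>) \<le> rate_under \<Phi> b W"
  proof (rule ereal_le_epsilon2)
    fix \<eta> :: real assume \<eta>: "0 < \<eta>"
    have "(INF \<eta>\<in>{0<..}. capacity_under \<Phi> b W S6 \<eta>) \<le> capacity_under \<Phi> b W S6 \<eta>"
      using \<eta> by (intro INF_lower) simp
    also have "\<dots> \<le> rate_under \<Phi> b W + ereal \<eta>"
      using capacity_under_le[where \<Phi>=\<Phi> and W=W and i=S6, OF b \<eta> _ \<Phi>] by simp
    finally show "(INF \<eta>\<in>{0<..}. capacity_under \<Phi> b W S6 \<eta>) \<le> rate_under \<Phi> b W + ereal \<eta>" .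
  qed
  show "rate_under \<Phi> b W \<le> (INF \<eta>\<in>{0<..}. capacity_under \<Phi> b W S6 \<eta>)"
    by (intro INF_greatest capacity_under_ge[where \<Phi>=\<Phi> and W=W, OF b _ _ \<Phi> \<Phi>0]) auto
qed

text \<open>With its liminf analogue, the stability of the error constraint under vanishing additive
  terms.\<close>

lemma limsup_add_vanishing_le:
  fixes f e \<delta> :: "nat \<Rightarrow> real"
  assumes "\<delta> \<longlonglongrightarrow> 0" and "\<forall>\<^sub>F n in sequentially. f n \<le> e n + \<delta> n"
  shows "limsup (\<lambda>n. ereal (f n)) \<le> limsup (\<lambda>n. ereal (e n))"
proof -
  have "limsup (\<lambda>n. ereal (f n)) \<le> limsup (\<lambda>n. ereal (\<delta> n) + ereal (e n))"
    using assms(2) by (intro Limsup_mono) (auto elim!: eventually_mono)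
  also have "\<dots> = 0 + limsup (\<lambda>n. ereal (e n))"
    by (rule ereal_limsup_lim_add) (use assms(1) in \<open>auto simp: zero_ereal_def\<close>)
  finally show ?thesis by simp
qed

lemma liminf_add_vanishing_le:
  fixes f e \<delta> :: "nat \<Rightarrow> real"
  assumes "\<delta> \<longlonglongrightarrow> 0" and "\<forall>\<^sub>F n in sequentially. f n \<le> e n + \<delta> n"
  shows "liminf (\<lambda>n. ereal (f n)) \<le> liminf (\<lambda>n. ereal (e n))"
proof -
  have "liminf (\<lambda>n. ereal (f n)) \<le> liminf (\<lambda>n. ereal (\<delta> n) + ereal (e n))"
    using assms(2) by (intro Liminf_mono) (auto elim!: eventually_mono)
  also have "\<dots> = 0 + liminf (\<lambda>n. ereal (e n))"
    by (rule ereal_liminf_lim_add) (use assms(1) in \<open>auto simp: zero_ereal_def\<close>)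
  finally show ?thesis by simp
qed

lemma secrecy_capacity_eq_capacity_under:
  "secrecy_capacity b W i \<eta> \<epsilon> = capacity_under (\<lambda>e. limsup (\<lambda>n. ereal (e n)) \<le> ereal \<epsilon>) b W i \<eta>"
  unfolding secrecy_capacity_def capacity_under_def achievable_def by simp

text \<open>The optimistically achievable rates are upward closed, so their infimum is the supremum of the others.\<close>
lemma optimistic_secrecy_capacity_eq_capacity_under:
  "optimistic_secrecy_capacity b W i \<eta> \<epsilon> = capacity_under (\<lambda>e. liminf (\<lambda>n. ereal (e n)) < ereal \<epsilon>) b W i \<eta>"
proof -
  let ?O = "{R. optimistically_achievable b W i \<eta> \<epsilon> R}"
  have up: "R' \<in> ?O" if "R \<in> ?O" "R \<le> R'" for R R'
  proof -
    have "ereal R \<le> ereal R'" using that(2) by simp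
    then have le: "ereal R \<le> x" if "ereal R' \<le> x" for x using that by (rule order_trans)
    show ?thesis
      unfolding mem_Collect_eq optimistically_achievable_def
    proof (intro allI impI)
      fix M e d enc dec
      assume "\<forall>n\<ge>1. wiretap_code b W i \<eta> n (M n) (e n) (d n) (enc n) (dec n)"
        and "ereal R' \<le> liminf (\<lambda>n. ereal (1 / real n * log b (real (M n))))" and "d \<longlonglongrightarrow> 0"
      then show "ereal \<epsilon> \<le> liminf (\<lambda>n. ereal (e n))"
        using that(1)[unfolded mem_Collect_eq optimistically_achievable_def, rule_format, of M e d enc dec] le by simp
    qed
  qed
  \<comment> \<open>Negating the universal statement over code sequences yields exactly one sequence
    of the required rate and leakage with \<open>liminf e < \<epsilon>\<close>.\<close>
  have "capacity_under (\<lambda>e. liminf (\<lambda>n. ereal (e n)) < ereal \<epsilon>) b W i \<eta> = Sup (ereal ` (- ?O))"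
    unfolding capacity_under_def optimistically_achievable_def
    by (simp only: Collect_neg_eq[symmetric] not_all not_imp not_le conj_ac)
  also have "\<dots> = Inf (ereal ` ?O)"
  proof (rule antisym)
    show "Sup (ereal ` (- ?O)) \<le> Inf (ereal ` ?O)"
    proof (intro Sup_least Inf_greatest)
      fix x y assume "x \<in> ereal ` (- ?O)" "y \<in> ereal ` ?O"
      then show "x \<le> y" using up by (force simp: not_le)
    qed
    \<comment> \<open>No gap is possible: a real number strictly between would lie in one of the two
      complementary sets.\<close>
    show "Inf (ereal ` ?O) \<le> Sup (ereal ` (- ?O))"
    proof (rule ccontr)
      assume "\<not> ?thesis"
      then obtain R where R: "Sup (ereal ` (- ?O)) < ereal R" "ereal R < Inf (ereal ` ?O)"
        by (meson ereal_dense2 not_le)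
      show False
      proof (cases "R \<in> ?O")
        case True
        then have "Inf (ereal ` ?O) \<le> ereal R" by (intro Inf_lower) auto
        then show False using R(2) by simp
      next
        case False
        then have "ereal R \<le> Sup (ereal ` (- ?O))" by (intro Sup_upper) auto
        then show False using R(1) by simp
      qed
    qed
  qed
  finally show ?thesis by (simp add: optimistic_secrecy_capacity_def)
qed

theorem theorem1:
  fixes b :: real
    and W :: "nat \<Rightarrow> 'x list \<Rightarrow> ('y list \<times> 'z list) pmf"
  assumes "b > 1"
    and "wiretap_channel W"
  shows "(\<forall>\<epsilon>\<in>{0..<1}.
           let T = (SUP P\<in>input_processes.
                 rate_difference (info_lower b \<epsilon> (joint_VY W P)) (info_upper b 1 (joint_VZ W P)))
           in (\<forall>i\<in>{S2, S3, S4}. \<forall>\<eta>>0. secrecy_capacity b W i \<eta> \<epsilon> = T) \<and>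
              (INF \<eta>\<in>{0<..}. secrecy_capacity b W S6 \<eta> \<epsilon>) = T) \<and>
         (\<forall>\<epsilon>\<in>{0<..1}.
           let T = (SUP P\<in>input_processes.
                 rate_difference (info_upper b \<epsilon> (joint_VY W P)) (info_upper b 1 (joint_VZ W P)))
           in (\<forall>i\<in>{S2, S3, S4}. \<forall>\<eta>>0. optimistic_secrecy_capacity b W i \<eta> \<epsilon> = T) \<and>
              (INF \<eta>\<in>{0<..}. optimistic_secrecy_capacity b W S6 \<eta> \<epsilon>) = T)"
proof (intro conjI ballI)
  fix \<epsilon> :: real assume \<epsilon>: "\<epsilon> \<in> {0..<1}"
  let ?\<Phi> = "\<lambda>e :: nat \<Rightarrow> real. limsup (\<lambda>n. ereal (e n)) \<le> ereal \<epsilon>"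
  have T: "(SUP P\<in>input_processes. rate_difference (info_lower b \<epsilon> (joint_VY W P)) (info_upper b 1 (joint_VZ W P)))
      = rate_under ?\<Phi> b W"
    by (simp add: rate_under_def info_lower_def eps_p_liminf_def)
  have "?\<Phi> f" if "?\<Phi> e" "\<delta> \<longlonglongrightarrow> 0" "\<forall>\<^sub>F n in sequentially. f n \<le> e n + \<delta> n" for f e \<delta>
    using limsup_add_vanishing_le[OF that(2,3)] that(1) by (rule order_trans)
  moreover have "?\<Phi> (\<lambda>_. 0)" using \<epsilon> by (simp add: Limsup_const)
  ultimately show "let T = (SUP P\<in>input_processes.
                 rate_difference (info_lower b \<epsilon> (joint_VY W P)) (info_upper b 1 (joint_VZ W P)))
           in (\<forall>i\<in>{S2, S3, S4}. \<forall>\<eta>>0. secrecy_capacity b W i \<eta> \<epsilon> = T) \<and>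
              (INF \<eta>\<in>{0<..}. secrecy_capacity b W S6 \<eta> \<epsilon>) = T"
    unfolding Let_def T secrecy_capacity_eq_capacity_under
    by (intro capacity_under_eq_rate_under[OF assms(1)])
next
  fix \<epsilon> :: real assume \<epsilon>: "\<epsilon> \<in> {0<..1}"
  let ?\<Phi> = "\<lambda>e :: nat \<Rightarrow> real. liminf (\<lambda>n. ereal (e n)) < ereal \<epsilon>"
  have T: "(SUP P\<in>input_processes. rate_difference (info_upper b \<epsilon> (joint_VY W P)) (info_upper b 1 (joint_VZ W P)))
      = rate_under ?\<Phi> b W"
    by (simp add: rate_under_def info_upper_def eps_p_limsup_def)
  have "?\<Phi> f" if "?\<Phi> e" "\<delta> \<longlonglongrightarrow> 0" "\<forall>\<^sub>F n in sequentially. f n \<le> e n + \<delta> n" for f e \<delta>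
    using liminf_add_vanishing_le[OF that(2,3)] that(1) by (rule le_less_trans)
  moreover have "?\<Phi> (\<lambda>_. 0)" using \<epsilon> by (simp add: Liminf_const)
  ultimately show "let T = (SUP P\<in>input_processes.
                 rate_difference (info_upper b \<epsilon> (joint_VY W P)) (info_upper b 1 (joint_VZ W P)))
           in (\<forall>i\<in>{S2, S3, S4}. \<forall>\<eta>>0. optimistic_secrecy_capacity b W i \<eta> \<epsilon> = T) \<and>
              (INF \<eta>\<in>{0<..}. optimistic_secrecy_capacity b W S6 \<eta> \<epsilon>) = T"
    unfolding Let_def T optimistic_secrecy_capacity_eq_capacity_under
    by (intro capacity_under_eq_rate_under[OF assms(1)])
qed

end
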